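(* Let $a>-\infty$, let $0\neq g\in\mathbf{SOC}(a,\infty)$ be non-constant, and let $A,B$ be self-adjoint operators on a complex Hilbert space with spectra in $(a,\infty)$. Then: (i) If $A>B$, then $g(A)<g(B)$. (ii) If $A-B\geq m>0$ for some scalar $m>0$, then $$g(B)-g(A)\geq g(\sigma_{B})-g(\sigma_{B}+m)\geq g(\sigma_{A}-m)-g(\sigma_{A})>0,$$ where $\sigma_{A}=\max\mathrm{sp}(A)$ and $\sigma_{B}=\max\mathrm{sp}(B)$.
   Context: Operators are bounded linear operators on a complex Hilbert space $\mathcal{H}$ (nonzero, otherwise arbitrary). $\mathrm{sp}(A)$ is the spectrum of $A$. $A\ge 0$ (positive) means $\langle Ax,x\rangle\ge 0$ for all $x\in\mathcal{H}$; $A>0$ means $A$ is positive and invertible; for self-adjoint $A,B$, $A\ge B$ means $A-B\ge 0$ and $A>B$ means $A-B>0$; a scalar $m$ in an operator inequality stands for $mI$. $g(A)$ denotes the continuous functional calculus. A continuous real-valued function $g$ on an interval $J$ is strongly operator convex on $J$, written $g\in\mathbf{SOC}(J)$, if $P g(PAP)P\le g(A)$ for every self-adjoint operator $A$ (on any complex Hilbert space) with spectrum in $J$ and every orthogonal projection $P$; here $g(PAP)$ is computed for the compression of $A$ to the range of $P$, so $Pg(PAP)P$ equals $g(PAP|_{P\mathcal{H}})$ on $P\mathcal{H}$ and $0$ on $(P\mathcal{H})^\perp$. *)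

theory Defs
  imports
    "HOL-Analysis.Analysis"
    "HOL-Computational_Algebra.Polynomial"
    "HOL-Algebra.Module"
begin

section \<open>Complex Hilbert spaces with explicit carrier\<close>

text \<open>
  Strong operator convexity quantifies over all Hilbert spaces, and the compression of an operator
  lives on a closed subspace; both are awkward when the space is a type.  A Hilbert space is
  therefore a module (in the sense of HOL-Algebra) over the field of complex numbers, together with
  an inner product.  The fields \<open>mult\<close> and \<open>one\<close> inherited from the module record play no role.
\<close>

definition complex_field :: "complex ring" where
  "complex_field = \<lparr>carrier = UNIV, mult = (*), one = 1, zero = 0, add = (+)\<rparr>"

record 'v hilbert = "(complex, 'v) module" +
  hinner :: "'v \<Rightarrow> 'v \<Rightarrow> complex"

definition hnorm :: "'v hilbert \<Rightarrow> 'v \<Rightarrow> real" where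
  "hnorm H x = sqrt (Re (hinner H x x))"

definition hilbert_space :: "'v hilbert \<Rightarrow> bool" where
  "hilbert_space H \<longleftrightarrow>
     Module.module complex_field H \<and>
     (\<forall>x\<in>carrier H. \<forall>y\<in>carrier H. \<forall>z\<in>carrier H.
        hinner H (x \<oplus>\<^bsub>H\<^esub> y) z = hinner H x z + hinner H y z) \<and>
     (\<forall>c. \<forall>x\<in>carrier H. \<forall>y\<in>carrier H. hinner H (c \<odot>\<^bsub>H\<^esub> x) y = c * hinner H x y) \<and>
     (\<forall>x\<in>carrier H. \<forall>y\<in>carrier H. hinner H y x = cnj (hinner H x y)) \<and>
     (\<forall>x\<in>carrier H. 0 \<le> Re (hinner H x x)) \<and>
     (\<forall>x\<in>carrier H. hinner H x x = 0 \<longrightarrow> x = \<zero>\<^bsub>H\<^esub>) \<and>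
     (\<forall>X. range X \<subseteq> carrier H \<and>
          (\<forall>e>0. \<exists>N. \<forall>m\<ge>N. \<forall>n\<ge>N. hnorm H (X m \<ominus>\<^bsub>H\<^esub> X n) < e) \<longrightarrow>
          (\<exists>l\<in>carrier H. (\<lambda>n::nat. hnorm H (X n \<ominus>\<^bsub>H\<^esub> l)) \<longlonglongrightarrow> 0))"


section \<open>Bounded operators\<close>

text \<open>
  Operators are extensional functions (\<open>undefined\<close> off the carrier), so that equality of HOL
  functions is equality of operators.
\<close>

definition bounded_ops :: "'v hilbert \<Rightarrow> ('v \<Rightarrow> 'v) set" where
  "bounded_ops H =
     {T \<in> carrier H \<rightarrow>\<^sub>E carrier H.
        (\<forall>x\<in>carrier H. \<forall>y\<in>carrier H. T (x \<oplus>\<^bsub>H\<^esub> y) = T x \<oplus>\<^bsub>H\<^esub> T y) \<and>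
        (\<forall>c. \<forall>x\<in>carrier H. T (c \<odot>\<^bsub>H\<^esub> x) = c \<odot>\<^bsub>H\<^esub> T x) \<and>
        (\<exists>K. \<forall>x\<in>carrier H. hnorm H (T x) \<le> K * hnorm H x)}"

definition op_norm :: "'v hilbert \<Rightarrow> ('v \<Rightarrow> 'v) \<Rightarrow> real" where
  "op_norm H T = (SUP x\<in>{x \<in> carrier H. hnorm H x \<le> 1}. hnorm H (T x))"

definition op_scalar :: "'v hilbert \<Rightarrow> complex \<Rightarrow> 'v \<Rightarrow> 'v" where
  "op_scalar H c = (\<lambda>x\<in>carrier H. c \<odot>\<^bsub>H\<^esub> x)"

definition op_diff :: "'v hilbert \<Rightarrow> ('v \<Rightarrow> 'v) \<Rightarrow> ('v \<Rightarrow> 'v) \<Rightarrow> 'v \<Rightarrow> 'v" where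
  "op_diff H S T = (\<lambda>x\<in>carrier H. S x \<ominus>\<^bsub>H\<^esub> T x)"

definition op_invertible :: "'v hilbert \<Rightarrow> ('v \<Rightarrow> 'v) \<Rightarrow> bool" where
  "op_invertible H T \<longleftrightarrow>
     (\<exists>S\<in>bounded_ops H. \<forall>x\<in>carrier H. S (T x) = x \<and> T (S x) = x)"

definition sp :: "'v hilbert \<Rightarrow> ('v \<Rightarrow> 'v) \<Rightarrow> complex set" where
  "sp H T = {z. \<not> op_invertible H (op_diff H T (op_scalar H z))}"

definition selfadjoint :: "'v hilbert \<Rightarrow> ('v \<Rightarrow> 'v) \<Rightarrow> bool" where
  "selfadjoint H T \<longleftrightarrow>
     T \<in> bounded_ops H \<and>
     (\<forall>x\<in>carrier H. \<forall>y\<in>carrier H. hinner H (T x) y = hinner H x (T y))"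

definition orth_projection :: "'v hilbert \<Rightarrow> ('v \<Rightarrow> 'v) \<Rightarrow> bool" where
  "orth_projection H P \<longleftrightarrow> selfadjoint H P \<and> (\<forall>x\<in>carrier H. P (P x) = P x)"

definition op_pos :: "'v hilbert \<Rightarrow> ('v \<Rightarrow> 'v) \<Rightarrow> bool" where
  "op_pos H T \<longleftrightarrow> (\<forall>x\<in>carrier H. hinner H (T x) x \<in> \<real>\<^sub>\<ge>\<^sub>0)"

definition op_ge :: "'v hilbert \<Rightarrow> ('v \<Rightarrow> 'v) \<Rightarrow> ('v \<Rightarrow> 'v) \<Rightarrow> bool" where
  "op_ge H S T \<longleftrightarrow> op_pos H (op_diff H S T)"

definition op_gt :: "'v hilbert \<Rightarrow> ('v \<Rightarrow> 'v) \<Rightarrow> ('v \<Rightarrow> 'v) \<Rightarrow> bool" where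
  "op_gt H S T \<longleftrightarrow> op_pos H (op_diff H S T) \<and> op_invertible H (op_diff H S T)"

text \<open>For self-adjoint \<open>T\<close> on a nonzero space the spectrum is real, compact and nonempty.\<close>

definition max_sp :: "'v hilbert \<Rightarrow> ('v \<Rightarrow> 'v) \<Rightarrow> real" where
  "max_sp H T = (GREATEST s. complex_of_real s \<in> sp H T)"


section \<open>Continuous functional calculus\<close>

definition poly_op :: "'v hilbert \<Rightarrow> real poly \<Rightarrow> ('v \<Rightarrow> 'v) \<Rightarrow> 'v \<Rightarrow> 'v" where
  "poly_op H p T =
     (\<lambda>x\<in>carrier H. finsum H (\<lambda>i. complex_of_real (coeff p i) \<odot>\<^bsub>H\<^esub> (T ^^ i) x) {..degree p})"

text \<open>
  For self-adjoint \<open>T\<close> and \<open>g\<close> continuous on the spectrum of \<open>T\<close>, the operator \<open>g(T)\<close> is the norm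
  limit of \<open>p\<^sub>n(T)\<close> for polynomials \<open>p\<^sub>n\<close> converging to \<open>g\<close> uniformly on the spectrum; the
  limit exists and does not depend on the polynomials.
\<close>

definition cfc :: "'v hilbert \<Rightarrow> (real \<Rightarrow> real) \<Rightarrow> ('v \<Rightarrow> 'v) \<Rightarrow> 'v \<Rightarrow> 'v" where
  "cfc H g T =
     (THE S. S \<in> bounded_ops H \<and>
        (\<exists>p :: nat \<Rightarrow> real poly.
           uniform_limit {t. complex_of_real t \<in> sp H T} (\<lambda>n. poly (p n)) g sequentially \<and>
           (\<lambda>n. op_norm H (op_diff H (poly_op H (p n) T) S)) \<longlonglongrightarrow> 0))"


section \<open>Strongly operator convex functions\<close>

definition range_space :: "'v hilbert \<Rightarrow> ('v \<Rightarrow> 'v) \<Rightarrow> 'v hilbert" where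
  "range_space H P = H\<lparr>carrier := P ` carrier H\<rparr>"

definition compression :: "'v hilbert \<Rightarrow> ('v \<Rightarrow> 'v) \<Rightarrow> ('v \<Rightarrow> 'v) \<Rightarrow> 'v \<Rightarrow> 'v" where
  "compression H P T = (\<lambda>x\<in>P ` carrier H. P (T (P x)))"

text \<open>
  The operator \<open>P g(PTP) P\<close> on \<open>H\<close>: the functional calculus is taken on the range of \<open>P\<close>, and the
  result is extended by \<open>0\<close> to the orthogonal complement.
\<close>

definition cfc_compression ::
  "'v hilbert \<Rightarrow> (real \<Rightarrow> real) \<Rightarrow> ('v \<Rightarrow> 'v) \<Rightarrow> ('v \<Rightarrow> 'v) \<Rightarrow> 'v \<Rightarrow> 'v" where
  "cfc_compression H g P T =
     (\<lambda>x\<in>carrier H. cfc (range_space H P) g (compression H P T) (P x))"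

text \<open>
  HOL cannot quantify over types inside a formula: \<open>SOC TYPE('v) J\<close> tests the defining inequality
  on every Hilbert space whose vectors are elements of \<open>'v\<close>.  A nonzero Hilbert space has at least
  continuum many vectors, so as soon as \<open>'v\<close> carries one it also carries a copy of every separable
  Hilbert space, of the direct sum of any two spaces it carries, etc.  The set \<open>J\<close> is meant to be
  an interval.
\<close>

definition SOC :: "'v itself \<Rightarrow> real set \<Rightarrow> (real \<Rightarrow> real) set" where
  "SOC _ J =
     {g. continuous_on J g \<and>
         (\<forall>(K :: 'v hilbert) T P.
            hilbert_space K \<and> selfadjoint K T \<and> sp K T \<subseteq> complex_of_real ` J \<and>
            orth_projection K P \<longrightarrow>
            op_ge K (cfc K g T) (cfc_compression K g P T))}"

end

theory Submission
  imports Defs "HOL-Computational_Algebra.Fundamental_Theorem_Algebra"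
begin

text \<open>
  Everything rests on one inequality. Let \<open>c\<^sup>2 + s\<^sup>2 = 1\<close> and let \<open>S\<close>, \<open>T\<close> be self-adjoint operators on \<open>H\<close> with
  spectra in \<open>(a, \<infinity>)\<close>. The map \<open>V v = (c v, s v)\<close> is an isometry from \<open>H\<close> into the direct sum of two copies
  of \<open>H\<close>, and the compression of the diagonal operator with entries \<open>S\<close>, \<open>T\<close> to the range of the
  projection \<open>V V\<^sup>*\<close> is, up to \<open>V\<close>, the operator \<open>c\<^sup>2 S + s\<^sup>2 T\<close>. Strong operator convexity applied to
  this projection says that, for all vectors \<open>u\<close> and \<open>w\<close> (lemma \<open>SOC_two_point\<close>),

  \<open>\<langle>g(c\<^sup>2 S + s\<^sup>2 T)(c u + s w), c u + s w\<rangle> \<le> \<langle>g(S) u, u\<rangle> + \<langle>g(T) w, w\<rangle>\<close>.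

  Three choices of the data give all that is needed about \<open>g\<close>.

  \<^item> Let \<open>S \<le> R\<close>, take \<open>w = 0\<close> and choose \<open>T = S + (R - S) / s\<^sup>2\<close>, so that \<open>c\<^sup>2 S + s\<^sup>2 T = R\<close>. Then
    \<open>c\<^sup>2 g(R) \<le> g(S)\<close>, and \<open>s \<rightarrow> 0\<close> shows that \<open>g\<close> reverses the order of operators (\<open>SOC_antimono\<close>). The
    spectrum of \<open>T\<close> may escape to the right as \<open>s \<rightarrow> 0\<close>; this is why the interval has to be unbounded.
  \<^item> Scalar operators and \<open>u = c v\<close>, \<open>w = s v\<close> show that \<open>g\<close> is convex (\<open>SOC_convex\<close>). Hence
    \<open>g t - g (t + m)\<close> decreases in \<open>t\<close>.
  \<^item> A decreasing convex function that is not strictly decreasing is constant on some ray, and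
    convexity alone does not exclude that. Comparing two non-commuting operators does: if \<open>g\<close> is constant on
    \<open>[y, \<infinity>)\<close>, order reversal forces \<open>g\<close> to be constant everywhere (\<open>SOC_constant_ray\<close>).

  Let now \<open>A - B \<ge> m > 0\<close>. Then \<open>g(A) \<le> g(B + m)\<close>, so \<open>g(B) - g(A)\<close> dominates \<open>g(B) - g(B + m)\<close>. The
  latter is a decreasing function of \<open>B\<close>, hence bounded below by its value at the right end \<open>\<sigma>\<^sub>B\<close> of the
  spectrum, and \<open>\<sigma>\<^sub>B \<le> \<sigma>\<^sub>A - m\<close> turns this value into the last bound. The first part of the theorem is
  a special case, because \<open>A > B\<close> implies \<open>A - B \<ge> m\<close> for some \<open>m > 0\<close>.

  The functional calculus is obtained from a single analytic fact: a coercive operator is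
  invertible (\<open>coercive_invertible\<close>). It puts the spectrum of a self-adjoint operator between the bounds of its
  quadratic form, and these bounds belong to the spectrum (\<open>spectrum_extremal\<close>). Factoring polynomials
  over the complex numbers then shows that \<open>p \<ge> \<kappa>\<close> on the spectrum of \<open>T\<close> implies \<open>p(T) \<ge> \<kappa>\<close>
  (\<open>rpoly_form_ge\<close>); with the approximation theorem of Weierstrass this constructs \<open>g(T)\<close> and transports
  positivity to it. Direct sums, compressions and eigenvectors are all treated by one principle: \<open>W T = T' W\<close>
  implies \<open>W g(T) = g(T') W\<close> (\<open>cfc_intertwine\<close>).
\<close>

section \<open>Geometry of a Hilbert space\<close>

locale hspace =
  fixes H :: "'v hilbert" (structure)
  assumes hilbert_space: "hilbert_space H"
begin

abbreviation "C \<equiv> carrier H"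
abbreviation "ip \<equiv> hinner H"
abbreviation "nm \<equiv> hnorm H"

lemmas hilbert_axioms_conj = hilbert_space[unfolded hilbert_space_def]

lemmas module_H = hilbert_axioms_conj[THEN conjunct1]

sublocale abelian_group H
  using module_H by (simp add: Module.module_def)

lemma smult_closed [simp]: "x \<in> C \<Longrightarrow> c \<odot> x \<in> C"
  using Module.module.smult_closed[OF module_H, of c x] by (simp add: complex_field_def)

lemmas ip_add_left [simp] = hilbert_axioms_conj[THEN conjunct2, THEN conjunct1, rule_format]

lemmas ip_smult_left [simp] = hilbert_axioms_conj[THEN conjunct2, THEN conjunct2, THEN conjunct1, rule_format]

lemmas ip_sym = hilbert_axioms_conj[THEN conjunct2, THEN conjunct2, THEN conjunct2, THEN conjunct1, rule_format]

lemmas Re_ip_self_nonneg = hilbert_axioms_conj[THEN conjunct2, THEN conjunct2, THEN conjunct2, THEN conjunct2, THEN conjunct1, rule_format]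

lemmas ip_self_eq_0D = hilbert_axioms_conj[THEN conjunct2, THEN conjunct2, THEN conjunct2, THEN conjunct2, THEN conjunct2, THEN conjunct1, rule_format]

lemmas complete_axiom = hilbert_axioms_conj[THEN conjunct2, THEN conjunct2, THEN conjunct2, THEN conjunct2, THEN conjunct2, THEN conjunct2, rule_format]

lemma ip_add_right [simp]:
  "\<lbrakk>x \<in> C; y \<in> C; z \<in> C\<rbrakk> \<Longrightarrow> ip z (x \<oplus> y) = ip z x + ip z y"
  by (simp add: ip_sym[of _ z])

lemma ip_smult_right [simp]: "\<lbrakk>x \<in> C; y \<in> C\<rbrakk> \<Longrightarrow> ip x (c \<odot> y) = cnj c * ip x y"
  by (simp add: ip_sym[of _ x])

lemma ip_zero_left [simp]: "z \<in> C \<Longrightarrow> ip \<zero> z = 0"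
  using ip_add_left[of \<zero> \<zero> z] by simp

lemma ip_zero_right [simp]: "z \<in> C \<Longrightarrow> ip z \<zero> = 0"
  using ip_add_right[of \<zero> \<zero> z] by simp

lemma ip_diff_left [simp]:
  assumes "x \<in> C" "y \<in> C" "z \<in> C"
  shows "ip (x \<ominus> y) z = ip x z - ip y z"
proof -
  have "ip (y \<oplus> \<ominus> y) z = ip y z + ip (\<ominus> y) z" using assms by (intro ip_add_left) auto
  then show ?thesis using assms by (simp add: a_minus_def r_neg eq_neg_iff_add_eq_0 add.commute)
qed

lemma ip_diff_right [simp]:
  "\<lbrakk>x \<in> C; y \<in> C; z \<in> C\<rbrakk> \<Longrightarrow> ip z (x \<ominus> y) = ip z x - ip z y"
  by (simp add: ip_sym[of _ z])

lemma nm_nonneg [simp]: "x \<in> C \<Longrightarrow> 0 \<le> nm x"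
  by (simp add: hnorm_def Re_ip_self_nonneg)

lemma nm_sq: "x \<in> C \<Longrightarrow> (nm x)\<^sup>2 = Re (ip x x)"
  by (simp add: hnorm_def Re_ip_self_nonneg)

lemma ip_self: "x \<in> C \<Longrightarrow> ip x x = of_real ((nm x)\<^sup>2)"
  using ip_sym[of x x] by (simp add: nm_sq complex_eq_iff)

lemma nm_eq_0 [simp]: "x \<in> C \<Longrightarrow> nm x = 0 \<longleftrightarrow> x = \<zero>"
  using ip_self_eq_0D[of x] ip_self[of x] hnorm_def[of H \<zero>] by auto

lemma nm_zero [simp]: "nm \<zero> = 0"
  by simp

lemma diff_eq_0D: "\<lbrakk>x \<in> C; y \<in> C; x \<ominus> y = \<zero>\<rbrakk> \<Longrightarrow> x = y"
  by (metis a_minus_def minus_equality minus_minus a_inv_closed)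

lemma diff_self [simp]: "x \<in> C \<Longrightarrow> x \<ominus> x = \<zero>"
  by (simp add: a_minus_def r_neg)

text \<open>
  Equations between vectors are proved by testing against all vectors, which turns them into
  identities between complex numbers.
\<close>

lemma vec_eqI:
  assumes "x \<in> C" "y \<in> C" "\<And>z. z \<in> C \<Longrightarrow> ip x z = ip y z"
  shows "x = y"
proof -
  have "ip (x \<ominus> y) (x \<ominus> y) = 0" using assms by (simp del: ip_diff_right)
  then have "(nm (x \<ominus> y))\<^sup>2 = 0" using assms by (simp add: nm_sq del: ip_diff_left ip_diff_right)
  then show ?thesis using assms diff_eq_0D by simp
qed

lemma smult_one: "x \<in> C \<Longrightarrow> 1 \<odot> x = x"
  by (rule vec_eqI) auto

lemma smult_add_left: "x \<in> C \<Longrightarrow> (a + b) \<odot> x = a \<odot> x \<oplus> b \<odot> x"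
  by (rule vec_eqI) (simp_all add: algebra_simps)

lemma smult_add_right: "\<lbrakk>x \<in> C; y \<in> C\<rbrakk> \<Longrightarrow> a \<odot> (x \<oplus> y) = a \<odot> x \<oplus> a \<odot> y"
  by (rule vec_eqI) (simp_all add: algebra_simps)

lemma smult_assoc: "x \<in> C \<Longrightarrow> (a * b) \<odot> x = a \<odot> (b \<odot> x)"
  by (rule vec_eqI) (simp_all add: algebra_simps)

lemma nm_smult:
  assumes "x \<in> C" shows "nm (c \<odot> x) = cmod c * nm x"
proof (rule power2_eq_imp_eq)
  have "(nm (c \<odot> x))\<^sup>2 = Re (c * cnj c * ip x x)"
    using assms by (simp add: nm_sq algebra_simps)
  also have "c * cnj c * ip x x = of_real ((cmod c * nm x)\<^sup>2)"
    using assms by (simp only: ip_self complex_mult_cnj cmod_power2 power_mult_distrib of_real_mult)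
  finally show "(nm (c \<odot> x))\<^sup>2 = (cmod c * nm x)\<^sup>2" by simp
qed (use assms in simp_all)

text \<open>
  A positive form need not be definite. With \<open>R\<close> the identity this is the usual inequality; for a
  general positive \<open>R\<close> it bounds \<open>R x\<close> by the form of \<open>R\<close> at \<open>x\<close>.
\<close>

lemma form_cauchy_schwarz:
  assumes closed: "\<And>x. x \<in> C \<Longrightarrow> R x \<in> C"
    and add: "\<And>x y. \<lbrakk>x \<in> C; y \<in> C\<rbrakk> \<Longrightarrow> R (x \<oplus> y) = R x \<oplus> R y"
    and smult: "\<And>c x. x \<in> C \<Longrightarrow> R (c \<odot> x) = c \<odot> R x"
    and sym: "\<And>x y. \<lbrakk>x \<in> C; y \<in> C\<rbrakk> \<Longrightarrow> ip (R x) y = ip x (R y)"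
    and pos: "\<And>x. x \<in> C \<Longrightarrow> 0 \<le> Re (ip (R x) x)"
    and x: "x \<in> C" and y: "y \<in> C"
  shows "(cmod (ip (R x) y))\<^sup>2 \<le> Re (ip (R x) x) * Re (ip (R y) y)"
proof -
  define \<beta> where "\<beta> = ip (R x) y"
  have yx: "ip (R y) x = cnj \<beta>"
    using x y closed sym[of y x] ip_sym[of "R x" y] by (simp add: \<beta>_def)
  have quad: "0 \<le> Re (ip (R x) x) - 2 * \<tau> * (cmod \<beta>)\<^sup>2 + \<tau>\<^sup>2 * (cmod \<beta>)\<^sup>2 * Re (ip (R y) y)" for \<tau> :: real
  proof -
    \<comment> \<open>The phase of \<open>t\<close> makes both cross terms equal to \<open>- \<tau> |\<beta>|\<^sup>2\<close>.\<close>
    define t where "t = - of_real \<tau> * \<beta>"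
    have "0 \<le> Re (ip (R (x \<oplus> t \<odot> y)) (x \<oplus> t \<odot> y))" using x y by (intro pos) auto
    also have "ip (R (x \<oplus> t \<odot> y)) (x \<oplus> t \<odot> y) =
        ip (R x) x + cnj t * \<beta> + t * cnj \<beta> + t * cnj t * ip (R y) y"
      using x y closed yx by (simp add: add smult \<beta>_def algebra_simps)
    also have "\<dots> = ip (R x) x + of_real (- 2 * \<tau> * (cmod \<beta>)\<^sup>2)
        + of_real (\<tau>\<^sup>2 * (cmod \<beta>)\<^sup>2) * ip (R y) y"
      unfolding t_def of_real_mult complex_norm_square by (simp add: algebra_simps power2_eq_square)
    finally show ?thesis by simp
  qed
  \<comment> \<open>The parameter \<open>1 / \<langle>R y, y\<rangle>\<close> minimises the quadratic polynomial; if it is linear, its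
    slope has to vanish.\<close>
  show ?thesis
  proof (cases "Re (ip (R y) y) = 0")
    case True
    have "\<beta> = 0"
    proof (rule ccontr)
      assume "\<beta> \<noteq> 0"
      then show False
        using quad[of "(Re (ip (R x) x) + 1) / (2 * (cmod \<beta>)\<^sup>2)"] True by (simp add: field_simps)
    qed
    then show ?thesis using True by (simp add: \<beta>_def)
  next
    case False
    then have g: "0 < Re (ip (R y) y)" using pos[OF y] by simp
    show ?thesis
      using quad[of "1 / Re (ip (R y) y)"] g
      by (simp add: \<beta>_def[symmetric] field_simps power2_eq_square)
  qed
qed

lemma cauchy_schwarz: "\<lbrakk>x \<in> C; y \<in> C\<rbrakk> \<Longrightarrow> cmod (ip x y) \<le> nm x * nm y"
  by (rule power2_le_imp_le)
    (use form_cauchy_schwarz[of "\<lambda>x. x" x y] in \<open>simp_all add: power_mult_distrib nm_sq[symmetric]\<close>)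

lemma nm_sq_add:
  "\<lbrakk>x \<in> C; y \<in> C\<rbrakk> \<Longrightarrow> (nm (x \<oplus> y))\<^sup>2 = (nm x)\<^sup>2 + 2 * Re (ip x y) + (nm y)\<^sup>2"
  using ip_sym[of x y] by (simp add: nm_sq)

lemma nm_sq_diff:
  "\<lbrakk>x \<in> C; y \<in> C\<rbrakk> \<Longrightarrow> (nm (x \<ominus> y))\<^sup>2 = (nm x)\<^sup>2 - 2 * Re (ip x y) + (nm y)\<^sup>2"
  using ip_sym[of x y] by (simp add: nm_sq)

lemma nm_triangle:
  assumes "x \<in> C" "y \<in> C" shows "nm (x \<oplus> y) \<le> nm x + nm y"
proof (rule power2_le_imp_le)
  have "Re (ip x y) \<le> nm x * nm y"
    using cauchy_schwarz[OF assms] complex_Re_le_cmod order_trans by blast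
  then show "(nm (x \<oplus> y))\<^sup>2 \<le> (nm x + nm y)\<^sup>2"
    using assms by (simp add: nm_sq_add power2_sum)
qed (use assms in simp)

lemma nm_diff_commute: "\<lbrakk>x \<in> C; y \<in> C\<rbrakk> \<Longrightarrow> nm (x \<ominus> y) = nm (y \<ominus> x)"
  by (rule power2_eq_imp_eq) (use ip_sym[of x y] in \<open>simp_all add: nm_sq_diff\<close>)

lemma nm_triangle_diff:
  assumes "x \<in> C" "y \<in> C" "z \<in> C" shows "nm (x \<ominus> z) \<le> nm (x \<ominus> y) + nm (y \<ominus> z)"
proof -
  have "x \<ominus> z = (x \<ominus> y) \<oplus> (y \<ominus> z)" using assms by (intro vec_eqI) auto
  then show ?thesis using nm_triangle[of "x \<ominus> y" "y \<ominus> z"] assms by simp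
qed

lemma complete:
  assumes "\<And>n::nat. X n \<in> C"
    and "\<And>e. e > 0 \<Longrightarrow> \<exists>N. \<forall>m\<ge>N. \<forall>n\<ge>N. nm (X m \<ominus> X n) < e"
  obtains l where "l \<in> C" "(\<lambda>n. nm (X n \<ominus> l)) \<longlonglongrightarrow> 0"
proof -
  have "range X \<subseteq> C" using assms(1) by auto
  then show ?thesis using assms(2) that complete_axiom[of X] by blast
qed

text \<open>
  The distance function of an abstract metric space has to be symmetric and nonnegative also off the
  carrier, where \<open>x \<ominus> y\<close> has no meaning; hence the default value 0.
\<close>

lemma metric: "Metric_space C (\<lambda>x y. if x \<in> C \<and> y \<in> C then nm (x \<ominus> y) else 0)"
  by unfold_locales (auto simp: nm_diff_commute nm_triangle_diff dest: diff_eq_0D)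

lemma mcomplete: "Metric_space.mcomplete C (\<lambda>x y. if x \<in> C \<and> y \<in> C then nm (x \<ominus> y) else 0)"
proof -
  interpret M: Metric_space C "\<lambda>x y. if x \<in> C \<and> y \<in> C then nm (x \<ominus> y) else 0" by (rule metric)
  show ?thesis
    unfolding M.mcomplete_def
  proof (intro allI impI)
    fix X assume X: "M.MCauchy X"
    then have ran: "X n \<in> C" for n by (auto simp: M.MCauchy_def)
    moreover have "\<exists>N. \<forall>m\<ge>N. \<forall>n\<ge>N. nm (X m \<ominus> X n) < e" if "e > 0" for e
      using X that ran by (auto simp: M.MCauchy_def)
    ultimately obtain l where "l \<in> C" "(\<lambda>n. nm (X n \<ominus> l)) \<longlonglongrightarrow> 0"
      using complete[of X] by blast
    then have "limitin M.mtopology X l sequentially"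
      using ran by (auto simp: M.limit_metric_sequentially LIMSEQ_iff)
    then show "\<exists>l. limitin M.mtopology X l sequentially" ..
  qed
qed

lemma tendsto_ip:
  assumes "\<And>n::nat. X n \<in> C" "l \<in> C" "(\<lambda>n. nm (X n \<ominus> l)) \<longlonglongrightarrow> 0" "z \<in> C"
  shows "(\<lambda>n. ip (X n) z) \<longlonglongrightarrow> ip l z"
proof -
  have "(\<lambda>n. nm (X n \<ominus> l) * nm z) \<longlonglongrightarrow> 0"
    using tendsto_mult_right[OF assms(3), of "nm z"] by simp
  then have "(\<lambda>n. ip (X n) z - ip l z) \<longlonglongrightarrow> 0"
  proof (rule Lim_null_comparison[rotated])
    show "\<forall>\<^sub>F n in sequentially. cmod (ip (X n) z - ip l z) \<le> nm (X n \<ominus> l) * nm z"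
      using cauchy_schwarz[of "X _ \<ominus> l" z] assms by (intro always_eventually) simp
  qed
  then show ?thesis by (simp add: LIM_zero_iff)
qed

section \<open>Bounded operators\<close>

abbreviation "B \<equiv> bounded_ops H"

lemma bop_closed [simp]: "\<lbrakk>T \<in> B; x \<in> C\<rbrakk> \<Longrightarrow> T x \<in> C"
  by (auto simp: bounded_ops_def)

lemma bop_add: "\<lbrakk>T \<in> B; x \<in> C; y \<in> C\<rbrakk> \<Longrightarrow> T (x \<oplus> y) = T x \<oplus> T y"
  by (auto simp: bounded_ops_def)

lemma bop_smult: "\<lbrakk>T \<in> B; x \<in> C\<rbrakk> \<Longrightarrow> T (c \<odot> x) = c \<odot> T x"
  by (auto simp: bounded_ops_def)

lemma diff_eq_smult: "\<lbrakk>x \<in> C; y \<in> C\<rbrakk> \<Longrightarrow> x \<ominus> y = x \<oplus> (-1) \<odot> y"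
  by (rule vec_eqI) auto

lemma bop_diff: "\<lbrakk>T \<in> B; x \<in> C; y \<in> C\<rbrakk> \<Longrightarrow> T (x \<ominus> y) = T x \<ominus> T y"
  by (simp add: diff_eq_smult bop_add bop_smult)

lemma bop_zero: "T \<in> B \<Longrightarrow> T \<zero> = \<zero>"
  using bop_smult[of T \<zero> 0] by (metis bop_closed ip_smult_left mult_zero_left vec_eqI ip_zero_left zero_closed smult_closed)

lemma bop_bound:
  assumes "T \<in> B" shows "\<exists>K>0. \<forall>x\<in>C. nm (T x) \<le> K * nm x"
proof -
  obtain K where K: "\<forall>x\<in>C. nm (T x) \<le> K * nm x" using assms by (auto simp: bounded_ops_def)
  have "nm (T x) \<le> (\<bar>K\<bar> + 1) * nm x" if "x \<in> C" for x
  proof -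
    have "K * nm x \<le> (\<bar>K\<bar> + 1) * nm x" using that by (intro mult_right_mono) auto
    then show ?thesis using K that by force
  qed
  then show ?thesis by (intro exI[of _ "\<bar>K\<bar> + 1"]) auto
qed

lemma bopI:
  assumes "\<And>x. x \<in> C \<Longrightarrow> f x \<in> C"
    and "\<And>x y. \<lbrakk>x \<in> C; y \<in> C\<rbrakk> \<Longrightarrow> f (x \<oplus> y) = f x \<oplus> f y"
    and "\<And>c x. x \<in> C \<Longrightarrow> f (c \<odot> x) = c \<odot> f x"
    and "\<And>x. x \<in> C \<Longrightarrow> nm (f x) \<le> K * nm x"
  shows "restrict f C \<in> B"
  unfolding bounded_ops_def using assms by (auto intro!: exI[of _ K])

lemma bop_ext: "\<lbrakk>S \<in> B; T \<in> B; \<And>x. x \<in> C \<Longrightarrow> S x = T x\<rbrakk> \<Longrightarrow> S = T"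
  unfolding bounded_ops_def using PiE_ext by blast

lemma bop_smult_op:
  assumes "T \<in> B" shows "restrict (\<lambda>x. c \<odot> T x) C \<in> B"
proof -
  obtain K where K: "K > 0" "\<And>x. x \<in> C \<Longrightarrow> nm (T x) \<le> K * nm x" using bop_bound[OF assms] by blast
  show ?thesis
  proof (rule bopI)
    fix x assume "x \<in> C"
    then show "nm (c \<odot> T x) \<le> (cmod c * K) * nm x"
      using K(2)[of x] assms by (simp add: nm_smult mult_left_mono mult.assoc)
  qed (use assms in \<open>auto intro!: vec_eqI simp: bop_add bop_smult algebra_simps\<close>)
qed
lemma op_diff_bop [simp]:
  assumes S: "S \<in> B" and T: "T \<in> B" shows "op_diff H S T \<in> B"
proof -
  obtain K where K: "K > 0" "\<And>x. x \<in> C \<Longrightarrow> nm (S x) \<le> K * nm x" using bop_bound[OF S] by blast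
  obtain L where L: "L > 0" "\<And>x. x \<in> C \<Longrightarrow> nm (T x) \<le> L * nm x" using bop_bound[OF T] by blast
  show ?thesis unfolding op_diff_def
  proof (rule bopI)
    fix x assume x: "x \<in> C"
    have "nm (S x \<ominus> T x) \<le> nm (S x) + nm (T x)"
      using nm_triangle[of "S x" "(-1) \<odot> T x"] x S T by (simp add: diff_eq_smult nm_smult)
    then show "nm (S x \<ominus> T x) \<le> (K + L) * nm x"
      using K(2)[OF x] L(2)[OF x] by (simp add: algebra_simps)
  qed (use S T in \<open>auto intro!: vec_eqI simp: bop_add bop_smult algebra_simps\<close>)
qed

lemma op_scalar_bop [simp]: "op_scalar H c \<in> B"
  unfolding op_scalar_def
  by (rule bopI[where K = "cmod c"]) (auto intro!: vec_eqI simp: nm_smult algebra_simps)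

lemma op_diff_apply [simp]: "x \<in> C \<Longrightarrow> op_diff H S T x = S x \<ominus> T x"
  by (simp add: op_diff_def)

lemma op_scalar_apply [simp]: "x \<in> C \<Longrightarrow> op_scalar H c x = c \<odot> x"
  by (simp add: op_scalar_def)

lemma bop_comb:
  assumes "S \<in> B" "T \<in> B"
  shows "restrict (\<lambda>x. b \<odot> S x \<oplus> c \<odot> T x) C \<in> B"
proof -
  have "restrict (\<lambda>x. b \<odot> S x \<oplus> c \<odot> T x) C =
      op_diff H (restrict (\<lambda>x. b \<odot> S x) C) (restrict (\<lambda>x. (- c) \<odot> T x) C)"
    unfolding op_diff_def by (rule restrict_ext) (use assms in \<open>auto intro!: vec_eqI\<close>)
  then show ?thesis using assms bop_smult_op by simp
qed

lemma op_invertible_cong: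
  "(\<And>x. x \<in> C \<Longrightarrow> S x = T x) \<Longrightarrow> op_invertible H S \<longleftrightarrow> op_invertible H T"
  unfolding op_invertible_def by (metis bop_closed)

lemma op_invertible_comp:
  assumes S: "op_invertible H S" and T: "op_invertible H T" 
    and SC: "\<And>x. x \<in> C \<Longrightarrow> S x \<in> C" and TC: "\<And>x. x \<in> C \<Longrightarrow> T x \<in> C"
  shows "op_invertible H (\<lambda>x. S (T x))"
proof -
  obtain S' where S': "S' \<in> B" "\<And>x. x \<in> C \<Longrightarrow> S' (S x) = x \<and> S (S' x) = x"
    using S by (auto simp: op_invertible_def)
  obtain T' where T': "T' \<in> B" "\<And>x. x \<in> C \<Longrightarrow> T' (T x) = x \<and> T (T' x) = x"
    using T by (auto simp: op_invertible_def)
  obtain K where K: "K > 0" "\<And>x. x \<in> C \<Longrightarrow> nm (S' x) \<le> K * nm x" using bop_bound[OF S'(1)] by blast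
  obtain L where L: "L > 0" "\<And>x. x \<in> C \<Longrightarrow> nm (T' x) \<le> L * nm x" using bop_bound[OF T'(1)] by blast
  have "restrict (\<lambda>x. T' (S' x)) C \<in> B"
  proof (rule bopI)
    fix x assume x: "x \<in> C"
    have "nm (T' (S' x)) \<le> L * nm (S' x)" using x S' L by simp
    also have "\<dots> \<le> L * (K * nm x)" using x K L by (intro mult_left_mono) auto
    finally show "nm (T' (S' x)) \<le> (L * K) * nm x" by (simp add: mult.assoc)
  qed (use S' T' in \<open>auto simp: bop_add bop_smult\<close>)
  moreover have "restrict (\<lambda>x. T' (S' x)) C (S (T x)) = x \<and> S (T (restrict (\<lambda>x. T' (S' x)) C x)) = x"
    if "x \<in> C" for x
    using that S' T' SC TC by simp
  ultimately show ?thesis unfolding op_invertible_def by blast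
qed

lemma op_invertible_scalar: "c \<noteq> 0 \<Longrightarrow> op_invertible H (\<lambda>x. c \<odot> x)"
  unfolding op_invertible_def
  by (intro bexI[of _ "op_scalar H (1 / c)"]) (auto intro!: vec_eqI)

text \<open>
  Coercivity makes \<open>T\<close> injective with bounded inverse. For surjectivity, a solution of \<open>T x = y\<close> is a fixed point
  of \<open>x \<mapsto> x - \<tau> (T x - y)\<close>, and for a small step \<open>\<tau>\<close> coercivity makes this map a contraction.
  The lemma is also used for \<open>T - z\<close> with non-real \<open>z\<close>, which is not self-adjoint.
\<close>

lemma coercive_invertible:
  assumes T: "T \<in> B" and "\<delta> > 0"
    and coer: "\<And>x. x \<in> C \<Longrightarrow> \<delta> * (nm x)\<^sup>2 \<le> Re (ip (T x) x)"
  shows "op_invertible H T"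
proof -
  obtain K0 where K0: "K0 > 0" "\<And>x. x \<in> C \<Longrightarrow> nm (T x) \<le> K0 * nm x" using bop_bound[OF T] by blast
  define K where "K = max K0 \<delta>"
  have K: "K > 0" "\<delta> \<le> K" "nm (T x) \<le> K * nm x" if "x \<in> C" for x
    using K0 that mult_right_mono[of K0 K "nm x"] by (force simp: K_def)+
  note Kpos = K(1,2)[OF zero_closed]
  have below: "\<delta> * nm x \<le> nm (T x)" if "x \<in> C" for x
  proof (cases "nm x = 0")
    case False
    have "\<delta> * nm x * nm x \<le> nm (T x) * nm x"
      using coer[OF that] cauchy_schwarz[of "T x" x] complex_Re_le_cmod[of "ip (T x) x"] that T
      by (simp add: power2_eq_square mult.assoc)
    then show ?thesis using False nm_nonneg[OF that] by simp
  qed (use T that in \<open>auto simp: bop_zero\<close>)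
  have inj: "x = y" if "x \<in> C" "y \<in> C" "T x = T y" for x y
  proof -
    have "\<delta> * nm (x \<ominus> y) \<le> 0" using below[of "x \<ominus> y"] that T by (simp add: bop_diff)
    then have "nm (x \<ominus> y) = 0"
      using \<open>\<delta> > 0\<close> nm_nonneg[OF minus_closed[OF that(1,2)]] by (simp add: mult_le_0_iff del: nm_eq_0 nm_nonneg)
    then show ?thesis using that by (simp add: diff_eq_0D)
  qed
  define d where "d = (\<lambda>x y. if x \<in> C \<and> y \<in> C then nm (x \<ominus> y) else 0)"
  interpret M: Metric_space C d unfolding d_def by (rule metric)
  have surj: "\<exists>x\<in>C. T x = y" if y: "y \<in> C" for y
  proof -
    \<comment> \<open>This step minimises the bound \<open>1 - 2 \<tau> \<delta> + \<tau>\<^sup>2 K\<^sup>2\<close> for the squared contraction factor;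
      \<open>\<delta> \<le> K\<close> keeps the minimum nonnegative.\<close>
    define \<tau> where "\<tau> = \<delta> / K\<^sup>2"
    define f where "f = (\<lambda>x. x \<ominus> of_real \<tau> \<odot> (T x \<ominus> y))"
    define k where "k = sqrt (1 - \<delta>\<^sup>2 / K\<^sup>2)"
    have \<tau>: "\<tau> > 0" using \<open>\<delta> > 0\<close> Kpos by (simp add: \<tau>_def)
    have le1: "\<delta>\<^sup>2 / K\<^sup>2 \<le> 1" "\<delta>\<^sup>2 / K\<^sup>2 > 0"
      using \<open>\<delta> > 0\<close> Kpos by (auto simp: power_mono)
    have fC: "f \<in> C \<rightarrow> C" using T y by (auto simp: f_def)
    have contr: "nm (f x \<ominus> f x') \<le> k * nm (x \<ominus> x')" if "x \<in> C" "x' \<in> C" for x x'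
    proof (rule power2_le_imp_le)
      define e where "e = x \<ominus> x'"
      have e: "e \<in> C" using that by (simp add: e_def)
      have "f x \<ominus> f x' = e \<ominus> of_real \<tau> \<odot> T e"
        using that T y by (intro vec_eqI) (auto simp: f_def e_def bop_diff algebra_simps)
      then have "(nm (f x \<ominus> f x'))\<^sup>2 = (nm e)\<^sup>2 - 2 * \<tau> * Re (ip e (T e)) + \<tau>\<^sup>2 * (nm (T e))\<^sup>2"
        using e T by (simp add: nm_sq_diff nm_smult power_mult_distrib)
      also have "Re (ip e (T e)) = Re (ip (T e) e)" using ip_sym[of e "T e"] e T by simp
      also have "(nm e)\<^sup>2 - 2 * \<tau> * Re (ip (T e) e) + \<tau>\<^sup>2 * (nm (T e))\<^sup>2
          \<le> (nm e)\<^sup>2 - 2 * \<tau> * (\<delta> * (nm e)\<^sup>2) + \<tau>\<^sup>2 * (K * nm e)\<^sup>2"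
        using coer[OF e] K(3)[OF e] \<tau> e T by (intro add_mono diff_mono mult_left_mono power_mono) auto
      also have "\<dots> = (1 - \<delta>\<^sup>2 / K\<^sup>2) * (nm e)\<^sup>2"
        using Kpos by (simp add: \<tau>_def field_simps power2_eq_square)
      also have "\<dots> = (k * nm e)\<^sup>2" using le1 by (simp add: k_def power_mult_distrib)
      finally show "(nm (f x \<ominus> f x'))\<^sup>2 \<le> (k * nm (x \<ominus> x'))\<^sup>2" by (simp add: e_def)
    qed (use that le1 in \<open>simp add: k_def\<close>)
    have "k < 1" using le1 by (simp add: k_def)
    have M.mcomplete unfolding d_def by (rule mcomplete)
    moreover have "d (f x) (f y) \<le> k * d x y" if "x \<in> C" "y \<in> C" for x y
      using that contr funcset_mem[OF fC] by (simp add: d_def)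
    moreover have "C \<noteq> {}" using zero_closed by blast
    ultimately obtain x where x: "x \<in> C" "f x = x"
      using M.Banach_fixedpoint_thm[of f k] fC \<open>k < 1\<close> by blast
    have "of_real \<tau> \<odot> (T x \<ominus> y) = x \<ominus> f x"
      using x(1) T y by (intro vec_eqI) (auto simp: f_def)
    also have "\<dots> = \<zero>" using x by (intro vec_eqI) auto
    finally have "\<tau> * nm (T x \<ominus> y) = 0" using nm_smult[of "T x \<ominus> y" "of_real \<tau>"] x T y \<tau>
      by (simp flip: nm_eq_0)
    then show ?thesis using \<tau> x T y by (auto intro!: bexI[of _ x] diff_eq_0D)
  qed
  define S where "S = (\<lambda>y. SOME x. x \<in> C \<and> T x = y)"
  have S: "S y \<in> C" "T (S y) = y" if "y \<in> C" for y
    using someI_ex[of "\<lambda>x. x \<in> C \<and> T x = y"] surj[OF that] by (auto simp: S_def)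
  have "restrict S C \<in> B"
  proof (rule bopI)
    fix x assume "x \<in> C"
    then show "nm (S x) \<le> (1 / \<delta>) * nm x"
      using below[of "S x"] S \<open>\<delta> > 0\<close> by (simp add: field_simps)
  next
    fix x y assume "x \<in> C" "y \<in> C"
    then show "S (x \<oplus> y) = S x \<oplus> S y" using S T by - (rule inj, simp_all add: bop_add)
  next
    fix c x assume "x \<in> C"
    then show "S (c \<odot> x) = c \<odot> S x" using S T by - (rule inj, simp_all add: bop_smult)
  qed (use S in simp)
  moreover have "S (T x) = x" if "x \<in> C" for x
    using that S T by - (rule inj, simp_all)
  ultimately show ?thesis
    unfolding op_invertible_def using S T by (intro bexI[of _ "restrict S C"]) simp_all
qed

end

context hspace begin

lemma op_invertible_smult:
  assumes "c \<noteq> 0" "T \<in> B" shows "op_invertible H (\<lambda>x. c \<odot> T x) \<longleftrightarrow> op_invertible H T"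
proof
  show "op_invertible H (\<lambda>x. c \<odot> T x)" if "op_invertible H T"
    using op_invertible_comp[OF op_invertible_scalar[OF assms(1)] that] assms by simp
  assume "op_invertible H (\<lambda>x. c \<odot> T x)"
  from op_invertible_comp[OF op_invertible_scalar[of "1 / c"] this]
  have "op_invertible H (\<lambda>x. (1 / c) \<odot> (c \<odot> T x))" using assms by simp
  moreover have "(1 / c) \<odot> (c \<odot> T x) = T x" if "x \<in> C" for x
    using that assms by (intro vec_eqI) auto
  ultimately show "op_invertible H T" by (subst op_invertible_cong[where T = "\<lambda>x. (1 / c) \<odot> (c \<odot> T x)"]) auto
qed

text \<open>
  The factor \<open>c\<close> rotates the numerical range of \<open>T\<close> into a right half-plane.
\<close>

lemma rotated_coercive_invertible:
  assumes T: "T \<in> B" and "\<delta> > 0" "c \<noteq> 0"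
    and coer: "\<And>x. x \<in> C \<Longrightarrow> \<delta> * (nm x)\<^sup>2 \<le> Re (c * ip (T x) x)"
  shows "op_invertible H T"
proof -
  have "op_invertible H (restrict (\<lambda>x. c \<odot> T x) C)"
    using assms by (intro coercive_invertible[OF bop_smult_op \<open>\<delta> > 0\<close>]) auto
  then have "op_invertible H (\<lambda>x. c \<odot> T x)"
    by (subst op_invertible_cong[where T = "restrict (\<lambda>x. c \<odot> T x) C"]) auto
  then show ?thesis using op_invertible_smult assms by simp
qed

text \<open>
  Invertibility bounds \<open>\<parallel>x\<parallel>\<close> by a multiple of \<open>\<parallel>R x\<parallel>\<close>, and the Cauchy-Schwarz inequality for the form
  of \<open>R\<close>, applied to \<open>x\<close> and \<open>R x\<close>, bounds \<open>\<parallel>R x\<parallel>\<^sup>2\<close> by a multiple of \<open>\<langle>R x, x\<rangle>\<close>.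
\<close>

lemma invertible_positive_coercive:
  assumes R: "R \<in> B" and sym: "\<And>x y. \<lbrakk>x \<in> C; y \<in> C\<rbrakk> \<Longrightarrow> ip (R x) y = ip x (R y)"
    and pos: "\<And>x. x \<in> C \<Longrightarrow> 0 \<le> Re (ip (R x) x)"
    and inv: "op_invertible H R"
  obtains \<delta> where "\<delta> > 0" "\<And>x. x \<in> C \<Longrightarrow> \<delta> * (nm x)\<^sup>2 \<le> Re (ip (R x) x)"
proof -
  obtain S where S: "S \<in> B" "\<And>x. x \<in> C \<Longrightarrow> S (R x) = x" using inv by (auto simp: op_invertible_def)
  obtain L where L: "L > 0" "\<And>x. x \<in> C \<Longrightarrow> nm (S x) \<le> L * nm x" using bop_bound[OF S(1)] by blast
  obtain K where K: "K > 0" "\<And>x. x \<in> C \<Longrightarrow> nm (R x) \<le> K * nm x" using bop_bound[OF R] by blast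
  show ?thesis
  proof
    show "1 / (L\<^sup>2 * K) > 0" using L K by simp
    fix x assume x: "x \<in> C"
    define q where "q = Re (ip (R x) x)"
    have 2: "(cmod (ip (R x) (R x)))\<^sup>2 \<le> q * Re (ip (R (R x)) (R x))"
      unfolding q_def using R x sym pos
      by (intro form_cauchy_schwarz) (auto simp: bop_add bop_smult)
    have 3: "cmod (ip (R x) (R x)) = (nm (R x))\<^sup>2"
      using R x by (simp add: ip_self norm_power)
    have 4: "Re (ip (R (R x)) (R x)) \<le> K * (nm (R x))\<^sup>2"
    proof -
      have "Re (ip (R (R x)) (R x)) \<le> nm (R (R x)) * nm (R x)"
        using cauchy_schwarz[of "R (R x)" "R x"] complex_Re_le_cmod[of "ip (R (R x)) (R x)"] R x by simp
      also have "\<dots> \<le> K * nm (R x) * nm (R x)" using K R x by (intro mult_right_mono) auto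
      finally show ?thesis by (simp add: power2_eq_square mult.assoc)
    qed
    have "q \<ge> 0" using pos x by (simp add: q_def)
    have "((nm (R x))\<^sup>2)\<^sup>2 \<le> q * (K * (nm (R x))\<^sup>2)"
      using 2 mult_left_mono[OF 4 \<open>q \<ge> 0\<close>] unfolding 3 by (rule order_trans)
    then have 0: "(nm (R x))\<^sup>2 * (nm (R x))\<^sup>2 \<le> (q * K) * (nm (R x))\<^sup>2"
      by (simp add: power2_eq_square algebra_simps)
    have 1: "(nm (R x))\<^sup>2 \<le> q * K"
    proof (cases "nm (R x) = 0")
      case False
      then show ?thesis using 0 by (intro mult_right_le_imp_le[OF 0]) simp
    qed (use \<open>q \<ge> 0\<close> K in simp)
    have "nm x \<le> L * nm (R x)" using L(2)[of "R x"] S x R by simp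
    then have "(nm x)\<^sup>2 \<le> (L * nm (R x))\<^sup>2" using x by (intro power_mono) auto
    also have "\<dots> \<le> L\<^sup>2 * (q * K)" using 1 by (simp add: power_mult_distrib mult_left_mono)
    finally show "1 / (L\<^sup>2 * K) * (nm x)\<^sup>2 \<le> Re (ip (R x) x)"
      using L K by (simp add: q_def field_simps)
  qed
qed

section \<open>Spectrum and quadratic form of a self-adjoint operator\<close>

lemma sa_bop [simp]: "selfadjoint H T \<Longrightarrow> T \<in> B"
  by (simp add: selfadjoint_def)

lemma sa_sym: "\<lbrakk>selfadjoint H T; x \<in> C; y \<in> C\<rbrakk> \<Longrightarrow> ip (T x) y = ip x (T y)"
  by (auto simp: selfadjoint_def)

lemma sa_Im: "\<lbrakk>selfadjoint H T; x \<in> C\<rbrakk> \<Longrightarrow> Im (ip (T x) x) = 0"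
  using sa_sym[of T x x] ip_sym[of "T x" x] by (simp add: complex_eq_iff)

lemma sa_diff [simp]: "\<lbrakk>selfadjoint H S; selfadjoint H T\<rbrakk> \<Longrightarrow> selfadjoint H (op_diff H S T)"
  unfolding selfadjoint_def by auto

lemma sa_scalar [simp]: "selfadjoint H (op_scalar H (of_real r))"
  unfolding selfadjoint_def by auto

text \<open>
  For \<open>z\<close> outside the interval, \<open>T - z\<close> is coercive after multiplication by \<open>\<i> / Im z\<close>, by 1 or by -1,
  depending on the side on which \<open>z\<close> lies.
\<close>

lemma spectrum_bounds:
  assumes T: "selfadjoint H T" and z: "z \<in> sp H T"
  shows spectrum_real: "Im z = 0"
    and spectrum_ge: "(\<And>x. x \<in> C \<Longrightarrow> \<alpha> * (nm x)\<^sup>2 \<le> Re (ip (T x) x)) \<Longrightarrow> \<alpha> \<le> Re z"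
    and spectrum_le: "(\<And>x. x \<in> C \<Longrightarrow> Re (ip (T x) x) \<le> \<beta> * (nm x)\<^sup>2) \<Longrightarrow> Re z \<le> \<beta>"
proof -
  let ?R = "op_diff H T (op_scalar H z)"
  have R: "?R \<in> B" using T by simp
  have ni: "\<not> op_invertible H ?R" using z by (simp add: sp_def)
  have form: "ip (?R x) x = ip (T x) x - z * (nm x)\<^sup>2" if "x \<in> C" for x
    using that T by (simp add: ip_self)
  show Im: "Im z = 0"
  proof (rule ccontr)
    assume *: "Im z \<noteq> 0"
    have "op_invertible H ?R"
      by (rule rotated_coercive_invertible[OF R zero_less_one, of "\<i> / of_real (Im z)"])
        (use * T sa_Im[OF T] in \<open>simp_all add: form Re_divide_of_real del: op_diff_apply\<close>)
    then show False using ni by simp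
  qed
  show "\<alpha> \<le> Re z" if "\<And>x. x \<in> C \<Longrightarrow> \<alpha> * (nm x)\<^sup>2 \<le> Re (ip (T x) x)"
  proof (rule ccontr)
    assume "\<not> \<alpha> \<le> Re z"
    then have "op_invertible H ?R"
      by (intro rotated_coercive_invertible[OF R, of "\<alpha> - Re z" 1])
        (use that Im in \<open>simp_all add: form algebra_simps del: op_diff_apply\<close>)
    then show False using ni by simp
  qed
  show "Re z \<le> \<beta>" if "\<And>x. x \<in> C \<Longrightarrow> Re (ip (T x) x) \<le> \<beta> * (nm x)\<^sup>2"
  proof (rule ccontr)
    assume "\<not> Re z \<le> \<beta>"
    then have "op_invertible H ?R"
      by (intro rotated_coercive_invertible[OF R, of "Re z - \<beta>" "-1"])
        (use that Im in \<open>simp_all add: form algebra_simps del: op_diff_apply\<close>)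
    then show False using ni by simp
  qed
qed

text \<open>
  Conversely the infimum (\<open>c = 1\<close>) and the supremum (\<open>c = -1\<close>) of the form over the unit sphere lie in the
  spectrum: at the extremum \<open>m\<close> the operator \<open>c (T - m)\<close> is positive, so if it were invertible it would be
  coercive and the bound could be improved.
\<close>

lemma spectrum_extremal:
  assumes T: "selfadjoint H T" and nontriv: "C \<noteq> {\<zero>}" and c: "c = 1 \<or> c = (-1 :: real)"
  obtains m where "complex_of_real m \<in> sp H T"
    and "\<And>x. x \<in> C \<Longrightarrow> 0 \<le> c * (Re (ip (T x) x) - m * (nm x)\<^sup>2)"
proof -
  obtain K where K: "K > 0" "\<And>x. x \<in> C \<Longrightarrow> nm (T x) \<le> K * nm x"
    using bop_bound T sa_bop by meson
  define W where "W = (\<lambda>x. c * Re (ip (T x) x)) ` {x \<in> C. nm x = 1}"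
  have normalize: "(1 / nm x) \<odot> x \<in> {x \<in> C. nm x = 1}" if "x \<in> C" "x \<noteq> \<zero>" for x
    using that by (simp add: nm_smult norm_divide)
  have "W \<noteq> {}"
  proof -
    obtain x where "x \<in> C" "x \<noteq> \<zero>" using nontriv zero_closed by blast
    then show ?thesis using normalize unfolding W_def by blast
  qed
  have bdd: "bdd_below W"
  proof (rule bdd_belowI)
    fix w assume "w \<in> W"
    then obtain x where x: "x \<in> C" "nm x = 1" "w = c * Re (ip (T x) x)" by (auto simp: W_def)
    have "\<bar>Re (ip (T x) x)\<bar> \<le> nm (T x) * nm x"
      using abs_Re_le_cmod[of "ip (T x) x"] cauchy_schwarz[of "T x" x] x T by simp
    then show "- K \<le> w" using K(2)[of x] x c by auto
  qed
  define \<mu> where "\<mu> = Inf W"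
  define m where "m = c * \<mu>"
  have cm: "c * m = \<mu>" using c by (auto simp: m_def)
  have pos: "0 \<le> c * (Re (ip (T x) x) - m * (nm x)\<^sup>2)" if x: "x \<in> C" for x
  proof (cases "x = \<zero>")
    case True then show ?thesis using T by (simp add: bop_zero)
  next
    case False
    define y where "y = (1 / nm x) \<odot> x"
    have y: "y \<in> {x \<in> C. nm x = 1}" unfolding y_def using normalize x False by blast
    have "c * Re (ip (T y) y) \<in> W" unfolding W_def using y by (intro imageI)
    then have "\<mu> \<le> c * Re (ip (T y) y)" unfolding \<mu>_def using bdd by (intro cInf_lower)
    also have "Re (ip (T y) y) = Re (ip (T x) x) / (nm x)\<^sup>2"
      using x T by (simp add: y_def bop_smult power2_eq_square)
    finally show ?thesis using x False cm nm_nonneg[of x]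
      by (simp add: field_simps mult.assoc[symmetric] del: nm_nonneg)
  qed
  have "complex_of_real m \<in> sp H T"
  proof (rule ccontr)
    define R where "R = restrict (\<lambda>x. of_real c \<odot> op_diff H T (op_scalar H (of_real m)) x) C"
    have D: "op_diff H T (op_scalar H (of_real m)) \<in> B" using T by simp
    have RB: "R \<in> B" unfolding R_def by (rule bop_smult_op[OF D])
    have form: "Re (ip (R x) x) = c * (Re (ip (T x) x) - m * (nm x)\<^sup>2)" if "x \<in> C" for x
      using that T by (simp add: R_def nm_sq)
    assume "complex_of_real m \<notin> sp H T"
    then have "op_invertible H (\<lambda>x. of_real c \<odot> op_diff H T (op_scalar H (of_real m)) x)"
      using c D by (subst op_invertible_smult) (auto simp: sp_def)
    then have inv: "op_invertible H R"
      by (subst op_invertible_cong[where T = "\<lambda>x. of_real c \<odot> op_diff H T (op_scalar H (of_real m)) x"])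
        (auto simp: R_def)
    obtain \<delta> where \<delta>: "\<delta> > 0" "\<And>x. x \<in> C \<Longrightarrow> \<delta> * (nm x)\<^sup>2 \<le> Re (ip (R x) x)"
    proof (rule invertible_positive_coercive[OF RB _ _ inv])
      show "ip (R x) y = ip x (R y)" if "x \<in> C" "y \<in> C" for x y
        using that T by (simp add: R_def sa_sym)
    qed (use form pos in auto)
    have "\<mu> + \<delta> \<le> Inf W"
    proof (rule cInf_greatest[OF \<open>W \<noteq> {}\<close>])
      fix w assume "w \<in> W"
      then obtain x where x: "x \<in> C" "nm x = 1" "w = c * Re (ip (T x) x)" by (auto simp: W_def)
      then show "\<mu> + \<delta> \<le> w" using \<delta>(2)[of x] form[of x] cm by (simp add: algebra_simps)
    qed
    then show False using \<open>\<delta> > 0\<close> by (simp add: \<mu>_def)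
  qed
  then show ?thesis using that pos by blast
qed

lemma max_sp_in_spectrum:
  assumes T: "selfadjoint H T" and nontriv: "C \<noteq> {\<zero>}"
  shows "complex_of_real (max_sp H T) \<in> sp H T"
    and "\<And>x. x \<in> C \<Longrightarrow> Re (ip (T x) x) \<le> max_sp H T * (nm x)\<^sup>2"
proof -
  obtain m where m: "complex_of_real m \<in> sp H T" "\<And>x. x \<in> C \<Longrightarrow> 0 \<le> -1 * (Re (ip (T x) x) - m * (nm x)\<^sup>2)"
    using spectrum_extremal[OF T nontriv, of "-1"] by blast
  have "max_sp H T = m" unfolding max_sp_def
  proof (rule Greatest_equality)
    fix s assume "complex_of_real s \<in> sp H T"
    then show "s \<le> m" using spectrum_le[OF T, of "of_real s" m] m(2) by force
  qed (use m in simp)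
  then show "complex_of_real (max_sp H T) \<in> sp H T"
    and "\<And>x. x \<in> C \<Longrightarrow> Re (ip (T x) x) \<le> max_sp H T * (nm x)\<^sup>2" using m by auto
qed

lemma max_sp_le:
  assumes T: "selfadjoint H T" and nontriv: "C \<noteq> {\<zero>}"
    and "\<And>x. x \<in> C \<Longrightarrow> Re (ip (T x) x) \<le> \<beta> * (nm x)\<^sup>2"
  shows "max_sp H T \<le> \<beta>"
  using spectrum_le[OF T max_sp_in_spectrum(1)[OF T nontriv], of \<beta>] assms by simp

section \<open>Polynomials of an operator\<close>

text \<open>
  Horner's scheme. Complex coefficients are allowed because polynomials will be split into linear factors.
\<close>

definition papp :: "('v \<Rightarrow> 'v) \<Rightarrow> complex poly \<Rightarrow> 'v \<Rightarrow> 'v" where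
  "papp T q x = fold_coeffs (\<lambda>c v. c \<odot> x \<oplus> T v) q \<zero>"

lemma papp_0 [simp]: "papp T 0 x = \<zero>"
  by (simp add: papp_def)

lemma papp_pCons:
  assumes "T \<in> B" "x \<in> C" shows "papp T (pCons c q) x = c \<odot> x \<oplus> T (papp T q x)"
proof (cases "q = 0 \<and> c = 0")
  case True
  have "0 \<odot> x = \<zero>" using assms by (intro vec_eqI) auto
  \<comment> \<open>The zero polynomial has no coefficients, so here the claim needs \<open>0 = 0 \<odot> x \<oplus> T 0\<close>.\<close>
  then show ?thesis using True assms by (simp add: bop_zero)
next
  case False
  then show ?thesis by (cases "q = 0") (auto simp: papp_def fold_coeffs_pCons_coeff_not_0_eq fold_coeffs_pCons_not_0_0_eq)
qed

lemma papp_closed [simp]: "\<lbrakk>T \<in> B; x \<in> C\<rbrakk> \<Longrightarrow> papp T q x \<in> C"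
  by (induction q) (auto simp: papp_pCons)

lemma papp_add: "\<lbrakk>T \<in> B; x \<in> C\<rbrakk> \<Longrightarrow> papp T (p + q) x = papp T p x \<oplus> papp T q x"
proof (induction p q rule: poly_induct2)
  case (pCons a p b q)
  then show ?case by (intro vec_eqI) (auto simp: papp_pCons bop_add algebra_simps)
qed simp

lemma papp_smult: "\<lbrakk>T \<in> B; x \<in> C\<rbrakk> \<Longrightarrow> papp T (Polynomial.smult c p) x = c \<odot> papp T p x"
proof (induction p)
  case 0 then show ?case by (intro vec_eqI) auto
next
  case (pCons a p)
  then show ?case by (intro vec_eqI) (auto simp: papp_pCons bop_smult algebra_simps)
qed

lemma papp_diff: "\<lbrakk>T \<in> B; x \<in> C\<rbrakk> \<Longrightarrow> papp T (p - q) x = papp T p x \<ominus> papp T q x"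
  using papp_add[of T x p "Polynomial.smult (-1) q"] papp_smult[of T x "-1" q] by (simp add: diff_eq_smult)

lemma papp_mult: "\<lbrakk>T \<in> B; x \<in> C\<rbrakk> \<Longrightarrow> papp T (p * q) x = papp T p (papp T q x)"
proof (induction p)
  case (pCons a p)
  then show ?case by (intro vec_eqI) (auto simp: papp_pCons papp_add papp_smult algebra_simps)
qed simp

lemma papp_const: "\<lbrakk>T \<in> B; x \<in> C\<rbrakk> \<Longrightarrow> papp T [:c:] x = c \<odot> x"
  by (simp add: papp_pCons bop_zero)

lemma papp_commute: "\<lbrakk>T \<in> B; x \<in> C\<rbrakk> \<Longrightarrow> papp T q (T x) = T (papp T q x)"
  by (induction q) (auto simp: papp_pCons bop_zero bop_add bop_smult)

lemma papp_bop:
  assumes T: "T \<in> B" shows "restrict (papp T q) C \<in> B"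
proof (induction q)
  case 0
  have "papp T 0 = (\<lambda>x. \<zero>)" by auto
  moreover have "restrict (\<lambda>x. \<zero>) C \<in> B"
    by (rule bopI[where K = 0]) (auto intro!: vec_eqI)
  ultimately show ?case by (simp only:)
next
  case (pCons a q)
  obtain L where L: "L > 0" "\<And>x. x \<in> C \<Longrightarrow> nm (T x) \<le> L * nm x" using bop_bound[OF T] by blast
  obtain K where K: "K > 0" "\<And>x. x \<in> C \<Longrightarrow> nm (papp T q x) \<le> K * nm x"
    using bop_bound[OF pCons.IH] by auto
  have lin: "papp T q (x \<oplus> y) = papp T q x \<oplus> papp T q y" "papp T q (c \<odot> x) = c \<odot> papp T q x"
    if "x \<in> C" "y \<in> C" for x y c
    using bop_add[OF pCons.IH that] bop_smult[OF pCons.IH that(1), of c] that by simp_all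
  show ?case
  proof (rule bopI)
    fix x assume x: "x \<in> C"
    have "nm (papp T (pCons a q) x) \<le> nm (a \<odot> x) + nm (T (papp T q x))"
      using x T by (simp add: papp_pCons nm_triangle)
    also have "\<dots> \<le> cmod a * nm x + L * nm (papp T q x)"
      using x T L by (simp add: nm_smult)
    also have "\<dots> \<le> cmod a * nm x + L * (K * nm x)"
      using x K L by (intro add_left_mono mult_left_mono) auto
    finally show "nm (papp T (pCons a q) x) \<le> (cmod a + L * K) * nm x"
      by (simp add: algebra_simps)
  qed (use T lin in \<open>auto intro!: vec_eqI simp: papp_pCons bop_add bop_smult algebra_simps\<close>)
qed

text \<open>
  Every linear factor \<open>T - r\<close> is invertible because the root \<open>r\<close> avoids the spectrum.
\<close>

lemma papp_invertible:
  assumes T: "T \<in> B" and "q \<noteq> 0" and "\<And>z. z \<in> sp H T \<Longrightarrow> poly q z \<noteq> 0"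
  shows "op_invertible H (papp T q)"
  using assms(2,3)
proof (induction "degree q" arbitrary: q)
  case 0
  then obtain c where "q = [:c:]" "c \<noteq> 0" by (metis degree_eq_zeroE pCons_0_0)
  then show ?case
    using op_invertible_scalar[of c] T papp_const
    by (subst op_invertible_cong[where T = "\<lambda>x. c \<odot> x"]) auto
next
  case (Suc n)
  have "\<not> constant (poly q)" using Suc.hyps(2) by (simp add: constant_degree)
  then obtain r where "poly q r = 0" using fundamental_theorem_of_algebra by blast
  then obtain p where q: "q = [:- r, 1:] * p" by (metis poly_eq_0_iff_dvd dvdE)
  then have "p \<noteq> 0" using Suc.prems by auto
  then have "degree q = Suc (degree p)" unfolding q by (subst degree_mult_eq) auto
  then have deg: "n = degree p" using Suc.hyps by simp
  have "op_invertible H (papp T p)"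
    using Suc.prems(2) by (intro Suc.hyps(1)[OF deg \<open>p \<noteq> 0\<close>]) (auto simp: q)
  moreover have "op_invertible H (papp T [:- r, 1:])"
  proof -
    have "r \<notin> sp H T" using Suc.prems(2) \<open>poly q r = 0\<close> by auto
    then have inv: "op_invertible H (op_diff H T (op_scalar H r))" by (simp add: sp_def)
    have eq: "papp T [:- r, 1:] x = op_diff H T (op_scalar H r) x" if "x \<in> C" for x
    proof -
      have "papp T [:1:] x = x" using that T by (simp add: papp_const smult_one)
      then have "papp T [:- r, 1:] x = (- r) \<odot> x \<oplus> T x" using that T by (simp add: papp_pCons[of T x "- r"])
      then show ?thesis using that T by (intro vec_eqI) simp_all
    qed
    show ?thesis by (rule iffD2[OF op_invertible_cong inv]) (rule eq)
  qed
  ultimately have inv: "op_invertible H (\<lambda>x. papp T [:- r, 1:] (papp T p x))"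
    using op_invertible_comp[of "papp T [:- r, 1:]" "papp T p"] T by simp
  show ?case
    by (rule iffD2[OF op_invertible_cong inv]) (use T q papp_mult in blast)
qed

abbreviation rpoly :: "('v \<Rightarrow> 'v) \<Rightarrow> real poly \<Rightarrow> 'v \<Rightarrow> 'v" where
  "rpoly T p \<equiv> papp T (map_poly complex_of_real p)"

lemma rpoly_sym:
  assumes T: "selfadjoint H T" and "x \<in> C" "y \<in> C"
  shows "ip (rpoly T p x) y = ip x (rpoly T p y)"
  using assms(2,3)
proof (induction p arbitrary: x y)
  case 0 then show ?case by simp
next
  case (pCons a p)
  then have "ip (T (rpoly T p x)) y = ip x (T (rpoly T p y))"
    using T by (simp add: sa_sym papp_commute)
  then show ?case using T pCons by (simp add: papp_pCons map_poly_pCons)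
qed

lemma rpoly_selfadjoint: "selfadjoint H T \<Longrightarrow> selfadjoint H (restrict (rpoly T p) C)"
  unfolding selfadjoint_def[of H "restrict (rpoly T p) C"] using papp_bop rpoly_sym by auto

lemma map_poly_of_real_diff:
  "map_poly complex_of_real (p - q) = map_poly of_real p - map_poly of_real q"
  by (intro poly_eqI) (simp add: coeff_map_poly)

lemma map_poly_of_real_mult:
  "map_poly complex_of_real (p * q) = map_poly of_real p * map_poly of_real q"
  by (intro poly_eqI) (simp add: coeff_map_poly coeff_mult)

lemma poly_map_poly_of_real: "poly (map_poly complex_of_real p) (of_real t) = of_real (poly p t)"
  by (induction p) (auto simp: map_poly_pCons)

text \<open>
  Let \<open>m\<close> be the lower bound of the form of \<open>p(T)\<close>. It lies in the spectrum of \<open>p(T)\<close>, so \<open>p(T) - m\<close> is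
  not invertible and \<open>p - m\<close> vanishes at a point of the spectrum of \<open>T\<close>; thus \<open>m\<close> is a value of \<open>p\<close> there.
\<close>

lemma rpoly_form_ge:
  assumes T: "selfadjoint H T" and nontriv: "C \<noteq> {\<zero>}"
    and ge: "\<And>t. complex_of_real t \<in> sp H T \<Longrightarrow> \<kappa> \<le> poly p t"
    and x: "x \<in> C"
  shows "\<kappa> * (nm x)\<^sup>2 \<le> Re (ip (rpoly T p x) x)"
proof -
  let ?S = "restrict (rpoly T p) C"
  obtain m where m: "complex_of_real m \<in> sp H ?S"
      "\<And>x. x \<in> C \<Longrightarrow> 0 \<le> 1 * (Re (ip (?S x) x) - m * (nm x)\<^sup>2)"
    using spectrum_extremal[OF rpoly_selfadjoint[OF T] nontriv, of 1] by blast
  let ?q = "map_poly complex_of_real (p - [:m:])"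
  have eq: "papp T ?q x = op_diff H ?S (op_scalar H (of_real m)) x" if "x \<in> C" for x
    using that T by (simp add: map_poly_of_real_diff papp_diff papp_const map_poly_pCons)
  have "\<not> op_invertible H (papp T ?q)"
  proof
    assume inv: "op_invertible H (papp T ?q)"
    have "op_invertible H (op_diff H ?S (op_scalar H (of_real m)))"
      by (rule iffD1[OF op_invertible_cong inv]) (rule eq)
    then show False using m(1) by (simp add: sp_def)
  qed
  then have "?q = 0 \<or> (\<exists>z\<in>sp H T. poly ?q z = 0)"
    using papp_invertible[of T ?q] T by auto
  \<comment> \<open>If \<open>p - m\<close> is the zero polynomial, any point of the nonempty spectrum will do.\<close>
  then obtain z where z: "z \<in> sp H T" "poly ?q z = 0"
    using spectrum_extremal[OF T nontriv, of 1] by (metis poly_0)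
  have zr: "z = of_real (Re z)" using spectrum_real[OF T z(1)] by (simp add: complex_eq_iff)
  then have "poly p (Re z) = m"
    using z(2) poly_map_poly_of_real[of "p - [:m:]" "Re z"] by simp
  then have "\<kappa> \<le> m" using ge[of "Re z"] zr z(1) by auto
  then have "\<kappa> * (nm x)\<^sup>2 \<le> m * (nm x)\<^sup>2" by (intro mult_right_mono) auto
  then show ?thesis using m(2)[OF x] x by simp
qed

text \<open>
  For self-adjoint \<open>T\<close>, \<open>\<parallel>p(T) x\<parallel>\<^sup>2 = \<langle>p\<^sup>2(T) x, x\<rangle>\<close>, and \<open>p\<^sup>2 \<le> \<epsilon>\<^sup>2\<close> on the spectrum.
\<close>

lemma rpoly_norm_le:
  assumes T: "selfadjoint H T" and nontriv: "C \<noteq> {\<zero>}"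
    and le: "\<And>t. complex_of_real t \<in> sp H T \<Longrightarrow> \<bar>poly p t\<bar> \<le> \<epsilon>"
    and x: "x \<in> C" and "\<epsilon> \<ge> 0"
  shows "nm (rpoly T p x) \<le> \<epsilon> * nm x"
proof (rule power2_le_imp_le)
  have "- (\<epsilon>\<^sup>2) * (nm x)\<^sup>2 \<le> Re (ip (rpoly T (0 - p * p) x) x)"
    using le abs_le_square_iff[of _ \<epsilon>] \<open>\<epsilon> \<ge> 0\<close>
    by (intro rpoly_form_ge[OF T nontriv _ x]) (force simp: power2_eq_square)
  also have "rpoly T (0 - p * p) x = \<zero> \<ominus> rpoly T p (rpoly T p x)"
    using T x by (simp only: map_poly_of_real_diff map_poly_of_real_mult papp_diff papp_mult sa_bop) simp
  also have "Re (ip (\<zero> \<ominus> rpoly T p (rpoly T p x)) x) = - (nm (rpoly T p x))\<^sup>2"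
    using T x rpoly_sym[OF T, of "rpoly T p x" x p] by (simp add: nm_sq)
  finally show "(nm (rpoly T p x))\<^sup>2 \<le> (\<epsilon> * nm x)\<^sup>2" by (simp add: power_mult_distrib)
qed (use assms in simp)

end

section \<open>The continuous functional calculus\<close>

text \<open>
  Convergence on all compact subintervals at once makes one sequence of polynomials serve every operator with
  spectrum in \<open>(a, \<infinity>)\<close>, so that functional calculi of different operators can be compared term by term.
\<close>

definition approximates :: "(nat \<Rightarrow> real poly) \<Rightarrow> (real \<Rightarrow> real) \<Rightarrow> real \<Rightarrow> bool" where
  "approximates p g a \<longleftrightarrow>
     (\<forall>u v. a < u \<longrightarrow> uniform_limit {u..v} (\<lambda>n. poly (p n)) g sequentially)"

lemma approximates_exist:
  assumes g: "continuous_on {a<..} g"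
  shows "\<exists>p. approximates p g a"
proof -
  \<comment> \<open>These intervals exhaust \<open>(a, \<infinity>)\<close>.\<close>
  have "\<exists>q. \<forall>t\<in>{a + 1 / Suc n..real n}. \<bar>g t - poly q t\<bar> < 1 / Suc n" for n
  proof -
    have "continuous_on {a + 1 / Suc n..real n} g"
      by (rule continuous_on_subset[OF g]) (auto intro: less_le_trans[of a "a + 1 / Suc n"])
    then obtain f where f: "real_polynomial_function f"
        "\<And>t. t \<in> {a + 1 / Suc n..real n} \<Longrightarrow> \<bar>g t - f t\<bar> < 1 / Suc n"
      using Stone_Weierstrass_real_polynomial_function[of "{a + 1 / Suc n..real n}" g "1 / Suc n"] by auto
    obtain c m where "f = (\<lambda>t. \<Sum>i\<le>m. c i * t ^ i)"
      using f(1) by (auto simp: real_polynomial_function_iff_sum)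
    then have "poly (\<Sum>i\<le>m. monom (c i) i) t = f t" for t
      by (simp add: poly_sum poly_monom)
    then show ?thesis using f(2) by (intro exI[of _ "\<Sum>i\<le>m. monom (c i) i"]) auto
  qed
  then obtain p where p: "\<And>n t. t \<in> {a + 1 / Suc n..real n} \<Longrightarrow> \<bar>g t - poly (p n) t\<bar> < 1 / Suc n"
    by metis
  have "uniform_limit {u..v} (\<lambda>n. poly (p n)) g sequentially" if "a < u" for u v
  proof (rule uniform_limitI)
    fix e :: real assume "e > 0"
    obtain N where N: "1 / Suc N < min e (u - a)"
      using reals_Archimedean[of "min e (u - a)"] \<open>e > 0\<close> \<open>a < u\<close> by (auto simp: inverse_eq_divide)
    obtain M where M: "v \<le> real M" using real_arch_simple by blast
    show "\<forall>\<^sub>F n in sequentially. \<forall>t\<in>{u..v}. dist (poly (p n) t) (g t) < e"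
      unfolding eventually_sequentially
    proof (intro exI[of _ "max N M"] allI impI ballI)
      fix n t assume n: "max N M \<le> n" and t: "t \<in> {u..v}"
      have "1 / Suc n \<le> 1 / Suc N" using n by (simp add: frac_le)
      then have "1 / Suc n < e" "1 / Suc n < u - a" using N by simp_all
      moreover have "t \<in> {a + 1 / Suc n..real n}"
        using t M n \<open>1 / Suc n < u - a\<close> by auto
      ultimately show "dist (poly (p n) t) (g t) < e"
        using p[of t n] by (simp add: dist_real_def abs_minus_commute)
    qed
  qed
  then show ?thesis unfolding approximates_def by blast
qed

context hspace begin

lemma bop_funpow_closed: "\<lbrakk>T \<in> B; x \<in> C\<rbrakk> \<Longrightarrow> (T ^^ i) x \<in> C"
  by (induction i) auto

lemma bop_finsum:
  assumes "T \<in> B" "f \<in> {..n::nat} \<rightarrow> C"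
  shows "T (finsum H f {..n}) = finsum H (\<lambda>i. T (f i)) {..n}"
  using assms(2)
proof (induction n)
  case 0
  then show ?case using assms(1) by (simp add: finsum_0 Pi_def)
next
  case (Suc n)
  then have f: "f \<in> {..n} \<rightarrow> C" "f (Suc n) \<in> C" by auto
  have "(\<lambda>i. T (f i)) \<in> {..Suc n} \<rightarrow> C" using Suc.prems assms(1) by (auto simp: Pi_iff)
  note sum = finsum_Suc[OF this]
  have "finsum H f {..n} \<in> C" using f by (intro finsum_closed) auto
  then have "T (finsum H f {..Suc n}) = T (f (Suc n)) \<oplus> T (finsum H f {..n})"
    using Suc.prems f assms(1) by (simp add: finsum_Suc bop_add)
  also have "\<dots> = finsum H (\<lambda>i. T (f i)) {..Suc n}"
    unfolding sum Suc.IH[OF f(1)] ..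
  finally show ?case .
qed

lemma poly_op_eq_rpoly:
  assumes T: "T \<in> B" and x: "x \<in> C" shows "poly_op H p T x = rpoly T p x"
proof (induction p)
  case 0
  have "0 \<odot> x = \<zero>" using x by (intro vec_eqI) auto
  then show ?case using x by (simp add: poly_op_def finsum_0 Pi_def)
next
  case (pCons a p)
  have cl: "(\<lambda>i. of_real (coeff q i) \<odot> (T ^^ i) x) \<in> A \<rightarrow> C" for q A
    using bop_funpow_closed[OF T x] by auto
  show ?case
  proof (cases "p = 0")
    case True
    then show ?thesis using x T by (simp add: poly_op_def finsum_0 Pi_def papp_const map_poly_pCons)
  next
    case False
    let ?f = "\<lambda>i. complex_of_real (coeff p i) \<odot> (T ^^ i) x"
    have "T (?f i) = complex_of_real (coeff (pCons a p) (Suc i)) \<odot> (T ^^ (Suc i)) x" for i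
      using bop_funpow_closed[OF T x] T by (simp add: bop_smult)
    then have "poly_op H (pCons a p) T x = finsum H (\<lambda>i. T (?f i)) {..degree p} \<oplus> of_real a \<odot> x"
      unfolding poly_op_def using False x finsum_Suc2[OF cl[of "pCons a p"], of "degree p"] by simp
    also have "finsum H (\<lambda>i. T (?f i)) {..degree p} = T (rpoly T p x)"
      using bop_finsum[OF T cl[of p], of "degree p"] pCons.IH x by (simp add: poly_op_def)
    finally show ?thesis using T x by (simp add: papp_pCons map_poly_pCons a_comm)
  qed
qed

lemma unit_ball_bdd:
  assumes "T \<in> B" shows "bdd_above ((\<lambda>x. nm (T x)) ` {x \<in> C. nm x \<le> 1})"
proof -
  obtain K where K: "K > 0" "\<And>x. x \<in> C \<Longrightarrow> nm (T x) \<le> K * nm x" using bop_bound[OF assms] by blast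
  have "nm (T x) \<le> K" if "x \<in> C" "nm x \<le> 1" for x
    using order_trans[OF K(2)[OF that(1)] mult_left_mono[OF that(2), of K]] K(1) by simp
  then show ?thesis by (intro bdd_aboveI2[of _ _ K]) auto
qed

lemma op_norm_ge:
  assumes T: "T \<in> B" and x: "x \<in> C" shows "nm (T x) \<le> op_norm H T * nm x"
proof (cases "x = \<zero>")
  case True then show ?thesis using T by (simp add: bop_zero)
next
  case False
  define y where "y = of_real (1 / nm x) \<odot> x"
  have "nm (T y) \<le> op_norm H T" unfolding op_norm_def
    by (rule cSUP_upper[OF _ unit_ball_bdd[OF T]]) (use x False in \<open>simp add: y_def nm_smult norm_divide\<close>)
  moreover have "nm (T y) = nm (T x) / nm x"
    using T x by (simp add: y_def bop_smult nm_smult norm_divide)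
  ultimately show ?thesis using x False nm_nonneg[OF x] by (simp add: field_simps less_le del: nm_nonneg)
qed

lemma op_norm_le:
  assumes "\<epsilon> \<ge> 0" "\<And>x. x \<in> C \<Longrightarrow> nm (T x) \<le> \<epsilon> * nm x" shows "op_norm H T \<le> \<epsilon>"
  unfolding op_norm_def
proof (rule cSUP_least)
  have "\<zero> \<in> {x \<in> C. nm x \<le> 1}" by simp
  then show "{x \<in> C. nm x \<le> 1} \<noteq> {}" by blast
  fix x assume "x \<in> {x \<in> C. nm x \<le> 1}"
  then show "nm (T x) \<le> \<epsilon>"
    using assms(2)[of x] mult_left_mono[of "nm x" 1 \<epsilon>] assms(1) by simp
qed

lemma op_norm_nonneg: "T \<in> B \<Longrightarrow> 0 \<le> op_norm H T"
  unfolding op_norm_def by (rule cSUP_upper2[OF unit_ball_bdd, of _ \<zero>]) auto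

abbreviation spr :: "('v \<Rightarrow> 'v) \<Rightarrow> real set" where
  "spr T \<equiv> {t. complex_of_real t \<in> sp H T}"

text \<open>
  The condition whose unique solution \<open>S\<close> is \<open>cfc H g T\<close>.
\<close>

definition cfc_rel :: "(real \<Rightarrow> real) \<Rightarrow> ('v \<Rightarrow> 'v) \<Rightarrow> ('v \<Rightarrow> 'v) \<Rightarrow> bool" where
  "cfc_rel g T S \<longleftrightarrow> S \<in> B \<and>
     (\<exists>p. uniform_limit (spr T) (\<lambda>n. poly (p n)) g sequentially \<and>
        (\<lambda>n. op_norm H (op_diff H (poly_op H (p n) T) S)) \<longlonglongrightarrow> 0)"

context
  fixes T :: "'v \<Rightarrow> 'v" and g :: "real \<Rightarrow> real"
  assumes T: "selfadjoint H T" and nontriv: "C \<noteq> {\<zero>}"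
begin

lemma rpoly_diff_norm_le:
  assumes "\<And>t. t \<in> spr T \<Longrightarrow> \<bar>poly p t - poly q t\<bar> \<le> e" "e \<ge> 0" "x \<in> C"
  shows "nm (rpoly T p x \<ominus> rpoly T q x) \<le> e * nm x"
  using rpoly_norm_le[OF T nontriv, of "p - q" e x] assms T
  by (simp add: map_poly_of_real_diff papp_diff)

lemma op_diff_poly_op:
  "x \<in> C \<Longrightarrow> op_diff H (poly_op H p T) S x = rpoly T p x \<ominus> S x"
  using T by (simp add: poly_op_eq_rpoly)

text \<open>
  The limit does not depend on the polynomials: two sequences that converge to \<open>g\<close> on the spectrum differ there
  by functions tending uniformly to 0, and \<open>rpoly_norm_le\<close> carries this over to the operators.
\<close>

lemma cfc_rel_tendsto:
  assumes rel: "cfc_rel g T S"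
    and q: "uniform_limit (spr T) (\<lambda>n. poly (q n)) g sequentially" and x: "x \<in> C"
  shows "(\<lambda>n. nm (rpoly T (q n) x \<ominus> S x)) \<longlonglongrightarrow> 0"
proof -
  obtain p where S: "S \<in> B" and p: "uniform_limit (spr T) (\<lambda>n. poly (p n)) g sequentially"
    and lim: "(\<lambda>n. op_norm H (op_diff H (poly_op H (p n) T) S)) \<longlonglongrightarrow> 0"
    using rel unfolding cfc_rel_def by blast
  have [simp]: "S x \<in> C" using S x by simp
  have D: "op_diff H (poly_op H (p n) T) S \<in> B" for n
  proof -
    have "op_diff H (poly_op H (p n) T) S = op_diff H (restrict (rpoly T (p n)) C) S"
      using T by (auto simp: op_diff_def poly_op_eq_rpoly)
    then show ?thesis using papp_bop S T by simp
  qed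
  have 1: "(\<lambda>n. nm (rpoly T (p n) x \<ominus> S x)) \<longlonglongrightarrow> 0"
  proof (rule Lim_null_comparison)
    show "(\<lambda>n. op_norm H (op_diff H (poly_op H (p n) T) S) * nm x) \<longlonglongrightarrow> 0"
      using tendsto_mult_right[OF lim, of "nm x"] by simp
    have "nm (rpoly T (p n) x \<ominus> S x) \<le> op_norm H (op_diff H (poly_op H (p n) T) S) * nm x" for n
      using op_norm_ge[OF D x] op_diff_poly_op[OF x] by metis
    then show "\<forall>\<^sub>F n in sequentially. norm (nm (rpoly T (p n) x \<ominus> S x))
        \<le> op_norm H (op_diff H (poly_op H (p n) T) S) * nm x"
      using x T by simp
  qed
  have 2: "(\<lambda>n. nm (rpoly T (q n) x \<ominus> rpoly T (p n) x)) \<longlonglongrightarrow> 0"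
  proof (rule tendstoI)
    fix e :: real assume "e > 0"
    define e' where "e' = e / (nm x + 1)"
    have nx: "0 \<le> nm x" using x by simp
    then have "e' > 0" using \<open>e > 0\<close> by (simp add: e'_def)
    have e': "e' * nm x < e" using nx \<open>e > 0\<close> by (simp add: e'_def field_simps)
    have "\<forall>\<^sub>F n in sequentially. \<forall>t\<in>spr T. dist (poly (q n) t - poly (p n) t) (g t - g t) < e'"
      by (rule uniform_limitD[OF uniform_limit_minus[OF q p] \<open>e' > 0\<close>])
    then show "\<forall>\<^sub>F n in sequentially. dist (nm (rpoly T (q n) x \<ominus> rpoly T (p n) x)) 0 < e"
    proof (rule eventually_mono)
      fix n assume "\<forall>t\<in>spr T. dist (poly (q n) t - poly (p n) t) (g t - g t) < e'"
      then have "nm (rpoly T (q n) x \<ominus> rpoly T (p n) x) \<le> e' * nm x"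
        using \<open>e' > 0\<close> x by (intro rpoly_diff_norm_le) (auto simp: less_imp_le)
      then show "dist (nm (rpoly T (q n) x \<ominus> rpoly T (p n) x)) 0 < e"
        using e' x T by simp
    qed
  qed
  show ?thesis
  proof (rule Lim_null_comparison)
    show "(\<lambda>n. nm (rpoly T (q n) x \<ominus> rpoly T (p n) x) + nm (rpoly T (p n) x \<ominus> S x)) \<longlonglongrightarrow> 0"
      using tendsto_add[OF 2 1] by simp
    show "\<forall>\<^sub>F n in sequentially. norm (nm (rpoly T (q n) x \<ominus> S x))
        \<le> nm (rpoly T (q n) x \<ominus> rpoly T (p n) x) + nm (rpoly T (p n) x \<ominus> S x)"
      using x T nm_triangle_diff by (intro always_eventually allI) simp
  qed
qed

lemma cfc_rel_unique:
  assumes S: "cfc_rel g T S" and S': "cfc_rel g T S'" shows "S = S'"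
proof (rule bop_ext)
  show B: "S \<in> B" "S' \<in> B" using S S' by (auto simp: cfc_rel_def)
  obtain p where p: "uniform_limit (spr T) (\<lambda>n. poly (p n)) g sequentially"
    using S by (auto simp: cfc_rel_def)
  fix x assume x: "x \<in> C"
  show "S x = S' x"
  proof (rule vec_eqI)
    fix z assume z: "z \<in> C"
    have "(\<lambda>n. ip (rpoly T (p n) x) z) \<longlonglongrightarrow> ip (S x) z"
      using x z B T by (intro tendsto_ip cfc_rel_tendsto[OF S p]) auto
    moreover have "(\<lambda>n. ip (rpoly T (p n) x) z) \<longlonglongrightarrow> ip (S' x) z"
      using x z B T by (intro tendsto_ip cfc_rel_tendsto[OF S' p]) auto
    ultimately show "ip (S x) z = ip (S' x) z" by (rule LIMSEQ_unique)
  qed (use x B in auto)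
qed

text \<open>
  By \<open>rpoly_norm_le\<close> the operators \<open>p\<^sub>n(T)\<close> form a Cauchy sequence in the operator norm. Its limit is
  built pointwise, from the completeness of \<open>H\<close>.
\<close>

lemma cfc_rel_exists:
  assumes p: "uniform_limit (spr T) (\<lambda>n. poly (p n)) g sequentially"
  shows "\<exists>S. cfc_rel g T S"
proof -
  have close: "\<exists>N. \<forall>m\<ge>N. \<forall>n\<ge>N. \<forall>x\<in>C. nm (rpoly T (p m) x \<ominus> rpoly T (p n) x) \<le> e * nm x"
    if "e > 0" for e
  proof -
    have "\<forall>\<^sub>F n in sequentially. \<forall>t\<in>spr T. dist (poly (p n) t) (g t) < e / 2"
      by (rule uniform_limitD[OF p]) (use that in simp)
    then obtain N where N: "\<And>n t. \<lbrakk>n \<ge> N; t \<in> spr T\<rbrakk> \<Longrightarrow> \<bar>poly (p n) t - g t\<bar> < e / 2"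
      unfolding eventually_sequentially dist_real_def by blast
    show ?thesis
    proof (intro exI[of _ N] allI impI ballI rpoly_diff_norm_le)
      fix m n t assume "N \<le> m" "N \<le> n" "t \<in> spr T"
      then show "\<bar>poly (p m) t - poly (p n) t\<bar> \<le> e" using N[of m t] N[of n t] by linarith
    qed (use that in auto)
  qed
  have "\<exists>l. l \<in> C \<and> (\<lambda>n. nm (rpoly T (p n) x \<ominus> l)) \<longlonglongrightarrow> 0" if x: "x \<in> C" for x
  proof -
    have "\<exists>N. \<forall>m\<ge>N. \<forall>n\<ge>N. nm (rpoly T (p m) x \<ominus> rpoly T (p n) x) < e" if "e > 0" for e
    proof -
      have nx: "0 \<le> nm x" using x by simp
      have *: "e / (nm x + 1) * nm x < e" using nx \<open>e > 0\<close> by (simp add: field_simps)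
      have "e / (nm x + 1) > 0" using nx \<open>e > 0\<close> by simp
      from close[OF this] show ?thesis using x * by (meson le_less_trans)
    qed
    then show ?thesis using complete[of "\<lambda>n. rpoly T (p n) x"] x T by (metis papp_closed sa_bop)
  qed
  then obtain S where S: "\<And>x. x \<in> C \<Longrightarrow> S x \<in> C"
      "\<And>x. x \<in> C \<Longrightarrow> (\<lambda>n. nm (rpoly T (p n) x \<ominus> S x)) \<longlonglongrightarrow> 0" by metis
  have limip: "(\<lambda>n. ip (rpoly T (p n) x) z) \<longlonglongrightarrow> ip (S x) z" if "x \<in> C" "z \<in> C" for x z
    using that S T by (intro tendsto_ip) auto
  have lin: "rpoly T q (x \<oplus> y) = rpoly T q x \<oplus> rpoly T q y" "rpoly T q (c \<odot> x) = c \<odot> rpoly T q x"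
    if "x \<in> C" "y \<in> C" for q x y c
    using bop_add[OF papp_bop that] bop_smult[OF papp_bop that(1)] that T by (metis a_closed restrict_apply' sa_bop smult_closed)+
  have bound: "\<exists>N. \<forall>n\<ge>N. \<forall>x\<in>C. nm (rpoly T (p n) x \<ominus> S x) \<le> e * nm x" if "e > 0" for e
  proof -
    obtain N where N: "\<And>m n x. \<lbrakk>m \<ge> N; n \<ge> N; x \<in> C\<rbrakk> \<Longrightarrow> nm (rpoly T (p m) x \<ominus> rpoly T (p n) x) \<le> e * nm x"
      using close[OF \<open>e > 0\<close>] by blast
    have "nm (rpoly T (p n) x \<ominus> S x) \<le> e * nm x" if "n \<ge> N" "x \<in> C" for n x
    proof (rule tendsto_lowerbound[of "\<lambda>m. e * nm x + nm (rpoly T (p m) x \<ominus> S x)" _ sequentially])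
      show "(\<lambda>m. e * nm x + nm (rpoly T (p m) x \<ominus> S x)) \<longlonglongrightarrow> e * nm x"
        using tendsto_add[OF tendsto_const S(2)[OF \<open>x \<in> C\<close>], of "e * nm x"] by simp
      show "\<forall>\<^sub>F m in sequentially. nm (rpoly T (p n) x \<ominus> S x) \<le> e * nm x + nm (rpoly T (p m) x \<ominus> S x)"
        unfolding eventually_sequentially
      proof (intro exI[of _ N] allI impI)
        fix m assume "N \<le> m"
        then show "nm (rpoly T (p n) x \<ominus> S x) \<le> e * nm x + nm (rpoly T (p m) x \<ominus> S x)"
          using N[OF \<open>n \<ge> N\<close> \<open>N \<le> m\<close> \<open>x \<in> C\<close>] S T \<open>x \<in> C\<close>
            nm_triangle_diff[of "rpoly T (p n) x" "rpoly T (p m) x" "S x"] by simp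
      qed
    qed simp
    then show ?thesis by blast
  qed
  have SB: "restrict S C \<in> B"
  proof -
    obtain N where N: "\<And>x. x \<in> C \<Longrightarrow> nm (rpoly T (p N) x \<ominus> S x) \<le> 1 * nm x"
      using bound[OF zero_less_one] by blast
    obtain K where K: "\<And>x. x \<in> C \<Longrightarrow> nm (rpoly T (p N) x) \<le> K * nm x"
      using bop_bound[OF papp_bop[OF sa_bop[OF T]], of "map_poly of_real (p N)"] by auto
    show ?thesis
    proof (rule bopI)
      fix x assume x: "x \<in> C"
      have "nm (S x) \<le> nm (rpoly T (p N) x) + nm ((-1) \<odot> (rpoly T (p N) x \<ominus> S x))"
      proof -
        have "S x = rpoly T (p N) x \<oplus> (-1) \<odot> (rpoly T (p N) x \<ominus> S x)"
          using x S T by (intro vec_eqI) auto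
        then show ?thesis
          using nm_triangle[of "rpoly T (p N) x" "(-1) \<odot> (rpoly T (p N) x \<ominus> S x)"] x S T by simp
      qed
      then show "nm (S x) \<le> (K + 1) * nm x"
        using N[OF x] K[OF x] x S T by (simp add: nm_smult algebra_simps)
    next
      fix x y assume xy: "x \<in> C" "y \<in> C"
      show "S (x \<oplus> y) = S x \<oplus> S y"
      proof (rule vec_eqI)
        fix z assume z: "z \<in> C"
        have "(\<lambda>n. ip (rpoly T (p n) (x \<oplus> y)) z) \<longlonglongrightarrow> ip (S x) z + ip (S y) z"
          using tendsto_add[OF limip[OF xy(1) z] limip[OF xy(2) z]] xy z T by (simp add: lin)
        then show "ip (S (x \<oplus> y)) z = ip (S x \<oplus> S y) z"
          using LIMSEQ_unique[OF limip[OF a_closed[OF xy] z]] xy z S by simp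
      qed (use xy S in auto)
    next
      fix c x assume x: "x \<in> C"
      show "S (c \<odot> x) = c \<odot> S x"
      proof (rule vec_eqI)
        fix z assume z: "z \<in> C"
        have "(\<lambda>n. ip (rpoly T (p n) (c \<odot> x)) z) \<longlonglongrightarrow> c * ip (S x) z"
          using tendsto_mult[OF tendsto_const limip[OF x z], of c] x z T by (simp add: lin)
        then show "ip (S (c \<odot> x)) z = ip (c \<odot> S x) z"
          using LIMSEQ_unique[OF limip[OF smult_closed[OF x] z]] x z S by simp
      qed (use x S in auto)
    qed (use S in auto)
  qed
  have "(\<lambda>n. op_norm H (op_diff H (poly_op H (p n) T) (restrict S C))) \<longlonglongrightarrow> 0"
  proof (rule tendstoI)
    fix e :: real assume e: "e > 0"
    obtain N where N: "\<And>n x. \<lbrakk>n \<ge> N; x \<in> C\<rbrakk> \<Longrightarrow> nm (rpoly T (p n) x \<ominus> S x) \<le> e / 2 * nm x"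
      using bound[of "e / 2"] e by auto
    show "\<forall>\<^sub>F n in sequentially. dist (op_norm H (op_diff H (poly_op H (p n) T) (restrict S C))) 0 < e"
      unfolding eventually_sequentially
    proof (intro exI[of _ N] allI impI)
      fix n assume n: "N \<le> n"
      let ?D = "op_diff H (poly_op H (p n) T) (restrict S C)"
      have "?D = op_diff H (restrict (rpoly T (p n)) C) (restrict S C)"
        using T by (auto simp: op_diff_def poly_op_eq_rpoly)
      then have "?D \<in> B" using papp_bop SB T by simp
      then have "0 \<le> op_norm H ?D" by (rule op_norm_nonneg)
      moreover have "op_norm H ?D \<le> e / 2"
        using N[OF n] e T by (intro op_norm_le) (simp_all add: poly_op_eq_rpoly)
      ultimately show "dist (op_norm H ?D) 0 < e" using e by simp
    qed
  qed
  then show ?thesis unfolding cfc_rel_def using SB p by blast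
qed

lemma cfc_rel_cfc:
  assumes p: "uniform_limit (spr T) (\<lambda>n. poly (p n)) g sequentially"
  shows "cfc_rel g T (cfc H g T)"
proof -
  have "cfc H g T = (THE S. cfc_rel g T S)" unfolding cfc_def cfc_rel_def ..
  moreover have "\<exists>!S. cfc_rel g T S" using cfc_rel_exists[OF p] cfc_rel_unique by blast
  ultimately show ?thesis by (metis theI')
qed

end

end

text \<open>
  The setting in which \<open>g(T)\<close> is well defined for every \<open>g\<close> that is continuous on \<open>(a, \<infinity>)\<close>.
\<close>

locale hspace_op = hspace H for H :: "'v hilbert" (structure) +
  fixes T :: "'v \<Rightarrow> 'v" and a :: real
  assumes sa: "selfadjoint H T" and nontriv: "C \<noteq> {\<zero>}"
    and spec: "sp H T \<subseteq> complex_of_real ` {a<..}"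
begin

lemma T_bop [simp]: "T \<in> B"
  using sa by simp

lemma form_gt:
  obtains \<alpha> where "a < \<alpha>" "\<And>x. x \<in> C \<Longrightarrow> \<alpha> * (nm x)\<^sup>2 \<le> Re (ip (T x) x)"
proof -
  obtain m where m: "complex_of_real m \<in> sp H T"
      "\<And>x. x \<in> C \<Longrightarrow> 0 \<le> 1 * (Re (ip (T x) x) - m * (nm x)\<^sup>2)"
    using spectrum_extremal[OF sa nontriv, of 1] by blast
  have "a < m" using m(1) spec by auto
  then show ?thesis using that m(2) by force
qed

lemma spectrum_subset_interval:
  obtains u where "a < u" "spr T \<subseteq> {u..max_sp H T}"
proof -
  obtain \<alpha> where \<alpha>: "a < \<alpha>" "\<And>x. x \<in> C \<Longrightarrow> \<alpha> * (nm x)\<^sup>2 \<le> Re (ip (T x) x)"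
    using form_gt by blast
  have "\<alpha> \<le> t \<and> t \<le> max_sp H T" if "complex_of_real t \<in> sp H T" for t
    using spectrum_ge[OF sa that \<alpha>(2)] spectrum_le[OF sa that max_sp_in_spectrum(2)[OF sa nontriv]]
    by simp
  then have "spr T \<subseteq> {\<alpha>..max_sp H T}" by auto
  then show ?thesis by (rule that[OF \<alpha>(1)])
qed

lemma approximates_uniform_limit:
  assumes "approximates p g a"
  shows "uniform_limit (spr T) (\<lambda>n. poly (p n)) g sequentially"
proof -
  obtain u where "a < u" "spr T \<subseteq> {u..max_sp H T}" using spectrum_subset_interval by blast
  then show ?thesis
    using assms uniform_limit_on_subset unfolding approximates_def by blast
qed

lemma cfc_bop: "approximates p g a \<Longrightarrow> cfc H g T \<in> B"
  using cfc_rel_cfc[OF sa nontriv approximates_uniform_limit] by (simp add: cfc_rel_def)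

lemma cfc_tendsto:
  assumes "approximates p g a" "x \<in> C"
  shows "(\<lambda>n. nm (rpoly T (p n) x \<ominus> cfc H g T x)) \<longlonglongrightarrow> 0"
  using cfc_rel_tendsto[OF sa nontriv cfc_rel_cfc[OF sa nontriv] ] approximates_uniform_limit assms
  by blast

lemma cfc_tendsto_ip:
  assumes "approximates p g a" "x \<in> C" "z \<in> C"
  shows "(\<lambda>n. ip (rpoly T (p n) x) z) \<longlonglongrightarrow> ip (cfc H g T x) z"
  using assms cfc_bop by (intro tendsto_ip cfc_tendsto) auto

lemma cfc_selfadjoint:
  assumes p: "approximates p g a" shows "selfadjoint H (cfc H g T)"
  unfolding selfadjoint_def
proof (intro conjI ballI)
  show "cfc H g T \<in> B" by (rule cfc_bop[OF p])
  fix x y assume xy: "x \<in> C" "y \<in> C"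
  have "(\<lambda>n. cnj (ip (rpoly T (p n) y) x)) \<longlonglongrightarrow> cnj (ip (cfc H g T y) x)"
    using cfc_tendsto_ip[OF p xy(2,1)] by (intro tendsto_intros)
  moreover have "cnj (ip (rpoly T (p n) y) x) = ip (rpoly T (p n) x) y" for n
    using xy ip_sym[of "rpoly T (p n) y" x] rpoly_sym[OF sa xy] by simp
  ultimately have "(\<lambda>n. ip (rpoly T (p n) x) y) \<longlonglongrightarrow> ip x (cfc H g T y)"
    using xy ip_sym[of "cfc H g T y" x] cfc_bop[OF p] by simp
  then show "ip (cfc H g T x) y = ip x (cfc H g T y)"
    using LIMSEQ_unique[OF cfc_tendsto_ip[OF p xy]] by blast
qed

end

text \<open>
  The relation \<open>W T = T' W\<close> passes to polynomials and then, \<open>W\<close> being bounded, to their limits. Instances are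
  the coordinate maps of a direct sum, the isometry onto the range of a projection, and the inclusion of
  an eigenspace.
\<close>

lemma cfc_intertwine:
  fixes H :: "'v hilbert" and K :: "'w hilbert"
  assumes H: "hspace_op H T a" and K: "hspace_op K T' a"
    and W: "\<And>x. x \<in> carrier H \<Longrightarrow> W x \<in> carrier K"
    and W_add: "\<And>x y. \<lbrakk>x \<in> carrier H; y \<in> carrier H\<rbrakk> \<Longrightarrow> W (x \<oplus>\<^bsub>H\<^esub> y) = W x \<oplus>\<^bsub>K\<^esub> W y"
    and W_smult: "\<And>c x. x \<in> carrier H \<Longrightarrow> W (c \<odot>\<^bsub>H\<^esub> x) = c \<odot>\<^bsub>K\<^esub> W x"
    and W_bound: "\<And>x. x \<in> carrier H \<Longrightarrow> hnorm K (W x) \<le> L * hnorm H x"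
    and WT: "\<And>x. x \<in> carrier H \<Longrightarrow> W (T x) = T' (W x)"
    and g: "continuous_on {a<..} g" and x: "x \<in> carrier H"
  shows "W (cfc H g T x) = cfc K g T' (W x)"
proof -
  interpret H: hspace_op H T a by (rule H)
  interpret K: hspace_op K T' a by (rule K)
  obtain p where p: "approximates p g a" using approximates_exist[OF g] by blast
  have W0: "W \<zero>\<^bsub>H\<^esub> = \<zero>\<^bsub>K\<^esub>"
  proof -
    have "W \<zero>\<^bsub>H\<^esub> \<oplus>\<^bsub>K\<^esub> W \<zero>\<^bsub>H\<^esub> = W \<zero>\<^bsub>H\<^esub>" using W_add[of "\<zero>\<^bsub>H\<^esub>" "\<zero>\<^bsub>H\<^esub>"] by simp
    then have "hinner K (W \<zero>\<^bsub>H\<^esub>) z + hinner K (W \<zero>\<^bsub>H\<^esub>) z = hinner K (W \<zero>\<^bsub>H\<^esub>) z" if "z \<in> carrier K" for z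
      using K.ip_add_left[of "W \<zero>\<^bsub>H\<^esub>" "W \<zero>\<^bsub>H\<^esub>" z] W[of "\<zero>\<^bsub>H\<^esub>"] that by simp
    then show ?thesis using W[of "\<zero>\<^bsub>H\<^esub>"] by (intro K.vec_eqI) auto
  qed
  have W_diff: "W (y \<ominus>\<^bsub>H\<^esub> z) = W y \<ominus>\<^bsub>K\<^esub> W z" if "y \<in> carrier H" "z \<in> carrier H" for y z
    using that W by (simp add: H.diff_eq_smult K.diff_eq_smult W_add W_smult)
  have poly: "W (H.papp T q x) = K.papp T' q (W x)" for q
  proof (induction q)
    case (pCons c q)
    then show ?case using x W WT by (simp add: H.papp_pCons K.papp_pCons W_add W_smult)
  qed (simp add: W0)
  have lim: "(\<lambda>n. hnorm K (K.rpoly T' (p n) (W x) \<ominus>\<^bsub>K\<^esub> W (cfc H g T x))) \<longlonglongrightarrow> 0"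
  proof (rule Lim_null_comparison)
    show "(\<lambda>n. L * hnorm H (H.rpoly T (p n) x \<ominus>\<^bsub>H\<^esub> cfc H g T x)) \<longlonglongrightarrow> 0"
      using tendsto_mult_left[OF H.cfc_tendsto[OF p x], of L] by simp
    show "\<forall>\<^sub>F n in sequentially. norm (hnorm K (K.rpoly T' (p n) (W x) \<ominus>\<^bsub>K\<^esub> W (cfc H g T x)))
        \<le> L * hnorm H (H.rpoly T (p n) x \<ominus>\<^bsub>H\<^esub> cfc H g T x)"
    proof (intro always_eventually allI)
      fix n
      show "norm (hnorm K (K.rpoly T' (p n) (W x) \<ominus>\<^bsub>K\<^esub> W (cfc H g T x)))
        \<le> L * hnorm H (H.rpoly T (p n) x \<ominus>\<^bsub>H\<^esub> cfc H g T x)"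
        using W_bound[of "H.rpoly T (p n) x \<ominus>\<^bsub>H\<^esub> cfc H g T x"] x W H.cfc_bop[OF p]
        by (simp add: W_diff poly)
    qed
  qed
  show ?thesis
  proof (rule K.vec_eqI)
    show Wc: "W (cfc H g T x) \<in> carrier K" using x W H.cfc_bop[OF p] by simp
    show "cfc K g T' (W x) \<in> carrier K" using x W K.cfc_bop[OF p] by simp
    fix z assume z: "z \<in> carrier K"
    have "(\<lambda>n. hinner K (K.rpoly T' (p n) (W x)) z) \<longlonglongrightarrow> hinner K (W (cfc H g T x)) z"
      using z x W Wc by (intro K.tendsto_ip lim) auto
    then show "hinner K (W (cfc H g T x)) z = hinner K (cfc K g T' (W x)) z"
      using LIMSEQ_unique[OF K.cfc_tendsto_ip[OF p W[OF x] z]] by simp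
  qed
qed

text \<open>
  A lower bound for the quadratic form is how the spectra of all constructed operators are located.
\<close>

lemma (in hspace) hspace_opI:
  assumes "selfadjoint H T" "C \<noteq> {\<zero>}" "a < \<alpha>"
    and ge: "\<And>x. x \<in> C \<Longrightarrow> \<alpha> * (nm x)\<^sup>2 \<le> Re (ip (T x) x)"
  shows "hspace_op H T a"
proof unfold_locales
  show "sp H T \<subseteq> complex_of_real ` {a<..}"
  proof
    fix z assume z: "z \<in> sp H T"
    have "z = of_real (Re z)" using spectrum_real[OF assms(1) z] by (simp add: complex_eq_iff)
    moreover have "\<alpha> \<le> Re z" using ge by (rule spectrum_ge[OF assms(1) z])
    ultimately show "z \<in> complex_of_real ` {a<..}" using \<open>a < \<alpha>\<close> by (intro image_eqI[of _ _ "Re z"]) auto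
  qed
qed (use assms in auto)

section \<open>Compression to the range of a projection\<close>

locale hspace_proj = hspace H for H :: "'v hilbert" (structure) +
  fixes P :: "'v \<Rightarrow> 'v"
  assumes proj: "orth_projection H P"
begin

abbreviation "R \<equiv> range_space H P"

lemma P_sa [simp]: "selfadjoint H P"
  using proj by (simp add: orth_projection_def)

lemma P_bop [simp]: "P \<in> B"
  by simp

lemma P_idem [simp]: "x \<in> C \<Longrightarrow> P (P x) = P x"
  using proj by (simp add: orth_projection_def)

lemma carrier_R: "carrier R = {x \<in> C. P x = x}"
  by (force simp: range_space_def image_iff)

lemma R_simps [simp]:
  "x \<oplus>\<^bsub>R\<^esub> y = x \<oplus> y" "\<zero>\<^bsub>R\<^esub> = \<zero>" "c \<odot>\<^bsub>R\<^esub> x = c \<odot> x" "hinner R x y = ip x y" "hnorm R x = nm x"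
  by (simp_all add: range_space_def hnorm_def)

lemma module_R: "Module.module complex_field R"
proof -
  interpret M: Module.module complex_field H by (rule module_H)
  have "submodule (P ` C) complex_field H"
  proof (rule M.submoduleI)
    show "\<ominus> x \<in> P ` C" if "x \<in> P ` C" for x
    proof -
      have x: "x \<in> C" "P x = x" using that by auto
      have "\<ominus> x = (-1) \<odot> x"
        using x(1) by (intro minus_equality vec_eqI) auto
      also have "\<dots> = P ((-1) \<odot> x)" using x by (simp add: bop_smult)
      finally show ?thesis using x by (metis imageI smult_closed)
    qed
    show "\<zero> \<in> P ` C" using bop_zero[OF P_bop] by (metis imageI zero_closed)
    show "x \<oplus> y \<in> P ` C" if "x \<in> P ` C" "y \<in> P ` C" for x y
    proof -
      have x: "x \<in> C" "P x = x" "y \<in> C" "P y = y" using that by auto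
      then have "x \<oplus> y = P (x \<oplus> y)" by (simp add: bop_add)
      then show ?thesis using x by (metis imageI a_closed)
    qed
    show "c \<odot> x \<in> P ` C" if "x \<in> P ` C" for c x
    proof -
      have x: "x \<in> C" "P x = x" using that by auto
      then have "c \<odot> x = P (c \<odot> x)" by (simp add: bop_smult)
      then show ?thesis using x by (metis imageI smult_closed)
    qed
  qed auto
  then show ?thesis
    unfolding range_space_def by (rule submodule.submodule_is_module[OF _ module_H])
qed

lemma R_minus [simp]:
  assumes "x \<in> carrier R" "y \<in> carrier R" shows "x \<ominus>\<^bsub>R\<^esub> y = x \<ominus> y"
proof -
  interpret R: abelian_group R using module_R by (simp add: Module.module_def)
  have "\<ominus>\<^bsub>R\<^esub> y \<in> carrier R" "\<ominus>\<^bsub>R\<^esub> y \<oplus>\<^bsub>R\<^esub> y = \<zero>\<^bsub>R\<^esub>"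
    using assms R.l_neg by auto
  then have "\<ominus> y = \<ominus>\<^bsub>R\<^esub> y"
    using assms by (intro minus_equality) (auto simp: carrier_R)
  then show ?thesis using assms by (simp add: a_minus_def)
qed

lemma hilbert_space_R: "hilbert_space R"
  unfolding hilbert_space_def
proof (intro conjI)
  show "Module.module complex_field R" by (rule module_R)
  show "\<forall>x\<in>carrier R. \<forall>y\<in>carrier R. hinner R y x = cnj (hinner R x y)"
    by (auto simp: carrier_R intro: ip_sym)
  show "\<forall>x\<in>carrier R. 0 \<le> Re (hinner R x x)"
    using Re_ip_self_nonneg by (simp add: carrier_R)
  show "\<forall>x\<in>carrier R. hinner R x x = 0 \<longrightarrow> x = \<zero>\<^bsub>R\<^esub>"
    using ip_self_eq_0D by (simp add: carrier_R)
  show "\<forall>X. range X \<subseteq> carrier R \<and>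
      (\<forall>e>0. \<exists>N. \<forall>m\<ge>N. \<forall>n\<ge>N. hnorm R (X m \<ominus>\<^bsub>R\<^esub> X n) < e) \<longrightarrow>
      (\<exists>l\<in>carrier R. (\<lambda>n::nat. hnorm R (X n \<ominus>\<^bsub>R\<^esub> l)) \<longlonglongrightarrow> 0)"
  proof (intro allI impI, elim conjE)
    fix X :: "nat \<Rightarrow> 'v"
    assume X: "range X \<subseteq> carrier R"
      and cau: "\<forall>e>0. \<exists>N. \<forall>m\<ge>N. \<forall>n\<ge>N. hnorm R (X m \<ominus>\<^bsub>R\<^esub> X n) < e"
    have XR: "X n \<in> carrier R" for n using X by blast
    then have XC: "X n \<in> C" and PX: "P (X n) = X n" for n by (auto simp: carrier_R)
    have "\<exists>N. \<forall>m\<ge>N. \<forall>n\<ge>N. nm (X m \<ominus> X n) < e" if "e > 0" for e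
      using cau that XR by simp
    then obtain l where l: "l \<in> C" "(\<lambda>n. nm (X n \<ominus> l)) \<longlonglongrightarrow> 0"
      using complete[of X] XC by blast
    have "P l = l"
    proof (rule vec_eqI)
      fix z assume z: "z \<in> C"
      have "(\<lambda>n. ip (X n) (P z)) \<longlonglongrightarrow> ip l (P z)" using l XC z by (intro tendsto_ip) auto
      moreover have "ip (X n) (P z) = ip (X n) z" for n
        using sa_sym[OF P_sa XC[of n] z] PX by simp
      moreover have "(\<lambda>n. ip (X n) z) \<longlonglongrightarrow> ip l z" using l XC z by (intro tendsto_ip) auto
      ultimately have "ip l (P z) = ip l z" using LIMSEQ_unique by simp
      then show "ip (P l) z = ip l z" using l z by (simp add: sa_sym)
    qed (use l in auto)
    then have lR: "l \<in> carrier R" using l by (simp add: carrier_R)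
    then show "\<exists>l\<in>carrier R. (\<lambda>n. hnorm R (X n \<ominus>\<^bsub>R\<^esub> l)) \<longlonglongrightarrow> 0"
      using l XR by (intro bexI[of _ l]) simp_all
  qed
qed (simp_all add: carrier_R)

lemma hspace_op_compression:
  assumes T: "selfadjoint H T" and nontriv: "carrier R \<noteq> {\<zero>}" and "a < \<alpha>"
    and ge: "\<And>x. x \<in> C \<Longrightarrow> \<alpha> * (nm x)\<^sup>2 \<le> Re (ip (T x) x)"
  shows "hspace_op R (compression H P T) a"
proof -
  interpret R: hspace R by unfold_locales (rule hilbert_space_R)
  have comp: "compression H P T = restrict (\<lambda>x. P (T x)) (carrier R)"
    unfolding compression_def by (auto simp: range_space_def restrict_def fun_eq_iff)
  obtain K where K: "K > 0" "\<And>x. x \<in> C \<Longrightarrow> nm (T x) \<le> K * nm x"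
    using bop_bound[OF sa_bop[OF T]] by blast
  obtain L where L: "L > 0" "\<And>x. x \<in> C \<Longrightarrow> nm (P x) \<le> L * nm x"
    using bop_bound[OF P_bop] by blast
  show ?thesis
  proof (rule R.hspace_opI[OF _ _ \<open>a < \<alpha>\<close>])
    have "compression H P T \<in> bounded_ops R"
      unfolding comp
    proof (rule R.bopI)
      fix x assume "x \<in> carrier R"
      then have x: "x \<in> C" by (simp add: carrier_R)
      have "nm (P (T x)) \<le> L * nm (T x)" using x T L by simp
      also have "\<dots> \<le> L * (K * nm x)" using x K L by (intro mult_left_mono) auto
      finally show "hnorm R (P (T x)) \<le> (L * K) * hnorm R x" by (simp add: mult.assoc)
    qed (use T in \<open>auto simp: carrier_R bop_add bop_smult\<close>)
    moreover have "hinner R (compression H P T x) y = hinner R x (compression H P T y)"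
      if "x \<in> carrier R" "y \<in> carrier R" for x y
    proof -
      have xy: "x \<in> C" "P x = x" "y \<in> C" "P y = y" using that by (simp_all add: carrier_R)
      have "ip (P (T x)) y = ip x (T y)" using xy T by (simp add: sa_sym)
      also have "\<dots> = ip x (P (T y))" using sa_sym[OF P_sa xy(1), of "T y"] xy T by simp
      finally show ?thesis using that by (simp add: comp)
    qed
    ultimately show "selfadjoint R (compression H P T)" unfolding selfadjoint_def by blast
    show "carrier R \<noteq> {\<zero>\<^bsub>R\<^esub>}" using nontriv by simp
    show "\<alpha> * (hnorm R x)\<^sup>2 \<le> Re (hinner R (compression H P T x) x)" if "x \<in> carrier R" for x
      using that T ge[of x] by (simp add: comp) (simp add: carrier_R sa_sym)
  qed
qed

end

section \<open>The direct sum of two copies of a Hilbert space\<close>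

text \<open>
  Strong operator convexity is available for spaces with vectors in a fixed type only, so the direct sum of
  \<open>H\<close> with itself has to live on the vectors of \<open>H\<close>: a vector \<open>x\<close> stands for the pair \<open>\<phi> x\<close>, where \<open>\<phi>\<close> is a
  bijection from the carrier onto its square. All operations are pulled back along \<open>\<phi>\<close>.
\<close>

definition double_space :: "'v hilbert \<Rightarrow> ('v \<Rightarrow> 'v \<times> 'v) \<Rightarrow> 'v hilbert" where
  "double_space H \<phi> =
     (let enc = inv_into (carrier H) \<phi> in
      \<lparr>carrier = carrier H, mult = mult H, one = one H, zero = enc (\<zero>\<^bsub>H\<^esub>, \<zero>\<^bsub>H\<^esub>),
       add = (\<lambda>x y. enc (fst (\<phi> x) \<oplus>\<^bsub>H\<^esub> fst (\<phi> y), snd (\<phi> x) \<oplus>\<^bsub>H\<^esub> snd (\<phi> y))),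
       smult = (\<lambda>c x. enc (c \<odot>\<^bsub>H\<^esub> fst (\<phi> x), c \<odot>\<^bsub>H\<^esub> snd (\<phi> x))),
       hinner = (\<lambda>x y. hinner H (fst (\<phi> x)) (fst (\<phi> y)) + hinner H (snd (\<phi> x)) (snd (\<phi> y)))\<rparr>)"

locale hspace_double = hspace H for H :: "'v hilbert" (structure) +
  fixes \<phi> :: "'v \<Rightarrow> 'v \<times> 'v"
  assumes nontriv: "C \<noteq> {\<zero>}" and bij: "bij_betw \<phi> C (C \<times> C)"
begin

definition "d1 x = fst (\<phi> x)"
definition "d2 x = snd (\<phi> x)"
definition "enc u w = inv_into C \<phi> (u, w)"
definition "K = double_space H \<phi>"

lemma d_closed [simp]: "x \<in> C \<Longrightarrow> d1 x \<in> C" "x \<in> C \<Longrightarrow> d2 x \<in> C"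
  using bij_betwE[OF bij] by (auto simp: d1_def d2_def mem_Times_iff)

lemma enc_closed [simp]: "\<lbrakk>u \<in> C; w \<in> C\<rbrakk> \<Longrightarrow> enc u w \<in> C"
  using bij unfolding enc_def by (intro inv_into_into) (simp add: bij_betw_def)

lemma d_enc [simp]: "\<lbrakk>u \<in> C; w \<in> C\<rbrakk> \<Longrightarrow> d1 (enc u w) = u" "\<lbrakk>u \<in> C; w \<in> C\<rbrakk> \<Longrightarrow> d2 (enc u w) = w"
  using bij_betw_inv_into_right[OF bij, of "(u, w)"] by (simp_all add: d1_def d2_def enc_def)

lemma double_eqI: "\<lbrakk>x \<in> C; y \<in> C; d1 x = d1 y; d2 x = d2 y\<rbrakk> \<Longrightarrow> x = y"
  using bij unfolding d1_def d2_def bij_betw_def inj_on_def by (metis prod_eq_iff)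

lemma carrier_K [simp]: "carrier K = C"
  by (simp add: K_def double_space_def Let_def)

lemma K_unfold:
  "x \<oplus>\<^bsub>K\<^esub> y = enc (d1 x \<oplus> d1 y) (d2 x \<oplus> d2 y)"
  "c \<odot>\<^bsub>K\<^esub> x = enc (c \<odot> d1 x) (c \<odot> d2 x)"
  "\<zero>\<^bsub>K\<^esub> = enc \<zero> \<zero>"
  by (simp_all add: K_def double_space_def Let_def enc_def d1_def d2_def)

lemma K_inner [simp]: "hinner K x y = ip (d1 x) (d1 y) + ip (d2 x) (d2 y)"
  by (simp add: K_def double_space_def Let_def d1_def d2_def)

lemma K_closed [simp]:
  "\<lbrakk>x \<in> C; y \<in> C\<rbrakk> \<Longrightarrow> x \<oplus>\<^bsub>K\<^esub> y \<in> C" "x \<in> C \<Longrightarrow> c \<odot>\<^bsub>K\<^esub> x \<in> C" "\<zero>\<^bsub>K\<^esub> \<in> C"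
  by (simp_all add: K_unfold)

lemma K_d [simp]:
  "\<lbrakk>x \<in> C; y \<in> C\<rbrakk> \<Longrightarrow> d1 (x \<oplus>\<^bsub>K\<^esub> y) = d1 x \<oplus> d1 y"
  "\<lbrakk>x \<in> C; y \<in> C\<rbrakk> \<Longrightarrow> d2 (x \<oplus>\<^bsub>K\<^esub> y) = d2 x \<oplus> d2 y"
  "x \<in> C \<Longrightarrow> d1 (c \<odot>\<^bsub>K\<^esub> x) = c \<odot> d1 x"
  "x \<in> C \<Longrightarrow> d2 (c \<odot>\<^bsub>K\<^esub> x) = c \<odot> d2 x"
  "d1 \<zero>\<^bsub>K\<^esub> = \<zero>" "d2 \<zero>\<^bsub>K\<^esub> = \<zero>"
  by (simp_all add: K_unfold)

lemma abelian_group_K: "abelian_group K"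
proof (rule abelian_groupI)
  fix x assume "x \<in> carrier K"
  then have x: "x \<in> C" by simp
  have neg: "\<ominus> y \<oplus> y = \<zero>" if "y \<in> C" for y using that by (simp add: l_neg)
  show "\<exists>y\<in>carrier K. y \<oplus>\<^bsub>K\<^esub> x = \<zero>\<^bsub>K\<^esub>"
  proof (rule bexI[of _ "enc (\<ominus> d1 x) (\<ominus> d2 x)"])
    show "enc (\<ominus> d1 x) (\<ominus> d2 x) \<oplus>\<^bsub>K\<^esub> x = \<zero>\<^bsub>K\<^esub>"
      by (rule double_eqI) (use x in \<open>simp_all add: neg\<close>)
  qed (use x in simp)
qed ((rule double_eqI; simp add: a_ac) | simp)+

lemma module_K: "Module.module complex_field K"
proof -
  interpret M: Module.module complex_field H by (rule module_H)
  show ?thesis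
  proof (rule moduleI[OF M.R.is_cring abelian_group_K])
  qed ((rule double_eqI; simp add: complex_field_def smult_add_left smult_add_right smult_assoc smult_one)
      | simp)+
qed

lemma K_minus [simp]:
  assumes "x \<in> C" "y \<in> C"
  shows "x \<ominus>\<^bsub>K\<^esub> y \<in> C" "d1 (x \<ominus>\<^bsub>K\<^esub> y) = d1 x \<ominus> d1 y" "d2 (x \<ominus>\<^bsub>K\<^esub> y) = d2 x \<ominus> d2 y"
proof -
  interpret K: abelian_group K by (rule abelian_group_K)
  have n: "\<ominus>\<^bsub>K\<^esub> y \<in> C" using K.a_inv_closed[of y] assms by simp
  have z: "\<ominus>\<^bsub>K\<^esub> y \<oplus>\<^bsub>K\<^esub> y = \<zero>\<^bsub>K\<^esub>" using K.l_neg[of y] assms by simp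
  show "x \<ominus>\<^bsub>K\<^esub> y \<in> C" using K.minus_closed[of x y] assms by simp
  have "\<ominus> d1 y = d1 (\<ominus>\<^bsub>K\<^esub> y)" using arg_cong[OF z, of d1] assms n by (intro minus_equality) auto
  then show "d1 (x \<ominus>\<^bsub>K\<^esub> y) = d1 x \<ominus> d1 y" using assms n by (simp add: a_minus_def)
  have "\<ominus> d2 y = d2 (\<ominus>\<^bsub>K\<^esub> y)" using arg_cong[OF z, of d2] assms n by (intro minus_equality) auto
  then show "d2 (x \<ominus>\<^bsub>K\<^esub> y) = d2 x \<ominus> d2 y" using assms n by (simp add: a_minus_def)
qed

lemma K_norm_sq: "x \<in> C \<Longrightarrow> (hnorm K x)\<^sup>2 = (nm (d1 x))\<^sup>2 + (nm (d2 x))\<^sup>2"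
  by (simp add: hnorm_def Re_ip_self_nonneg)

lemma K_norm: "x \<in> C \<Longrightarrow> hnorm K x = sqrt ((nm (d1 x))\<^sup>2 + (nm (d2 x))\<^sup>2)"
  by (simp add: hnorm_def Re_ip_self_nonneg)

lemma K_norm_ge: "x \<in> C \<Longrightarrow> nm (d1 x) \<le> hnorm K x" "x \<in> C \<Longrightarrow> nm (d2 x) \<le> hnorm K x"
  by (simp_all add: K_norm)

lemma hilbert_space_K: "hilbert_space K"
  unfolding hilbert_space_def
proof (intro conjI)
  show "Module.module complex_field K" by (rule module_K)
  show "\<forall>x\<in>carrier K. \<forall>y\<in>carrier K. hinner K y x = cnj (hinner K x y)"
  proof (intro ballI)
    fix x y assume "x \<in> carrier K" "y \<in> carrier K"
    then show "hinner K y x = cnj (hinner K x y)"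
      using ip_sym[of "d1 x" "d1 y"] ip_sym[of "d2 x" "d2 y"] by simp
  qed
  show "\<forall>x\<in>carrier K. 0 \<le> Re (hinner K x x)"
    by (simp add: Re_ip_self_nonneg)
  show "\<forall>x\<in>carrier K. hinner K x x = 0 \<longrightarrow> x = \<zero>\<^bsub>K\<^esub>"
  proof (intro ballI impI)
    fix x assume x: "x \<in> carrier K" and "hinner K x x = 0"
    then have "(nm (d1 x))\<^sup>2 + (nm (d2 x))\<^sup>2 = 0" by (simp add: nm_sq flip: plus_complex.sel)
    then have "nm (d1 x) = 0" "nm (d2 x) = 0" by (simp_all add: sum_power2_eq_zero_iff)
    then have "d1 x = \<zero>" "d2 x = \<zero>" using x by simp_all
    then show "x = \<zero>\<^bsub>K\<^esub>" using x by - (rule double_eqI, simp_all)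
  qed
  show "\<forall>X. range X \<subseteq> carrier K \<and>
      (\<forall>e>0. \<exists>N. \<forall>m\<ge>N. \<forall>n\<ge>N. hnorm K (X m \<ominus>\<^bsub>K\<^esub> X n) < e) \<longrightarrow>
      (\<exists>l\<in>carrier K. (\<lambda>n::nat. hnorm K (X n \<ominus>\<^bsub>K\<^esub> l)) \<longlonglongrightarrow> 0)"
  proof (intro allI impI, elim conjE)
    fix X :: "nat \<Rightarrow> 'v"
    assume "range X \<subseteq> carrier K"
      and cau: "\<forall>e>0. \<exists>N. \<forall>m\<ge>N. \<forall>n\<ge>N. hnorm K (X m \<ominus>\<^bsub>K\<^esub> X n) < e"
    then have X: "X n \<in> C" for n by auto
    have 1: "\<exists>N. \<forall>m\<ge>N. \<forall>n\<ge>N. nm (d1 (X m) \<ominus> d1 (X n)) < e" if "e > 0" for e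
      using cau that K_norm_ge(1)[of "X _ \<ominus>\<^bsub>K\<^esub> X _"] X by (simp add: X) (meson le_less_trans)
    have 2: "\<exists>N. \<forall>m\<ge>N. \<forall>n\<ge>N. nm (d2 (X m) \<ominus> d2 (X n)) < e" if "e > 0" for e
      using cau that K_norm_ge(2)[of "X _ \<ominus>\<^bsub>K\<^esub> X _"] X by (simp add: X) (meson le_less_trans)
    obtain u where u: "u \<in> C" "(\<lambda>n. nm (d1 (X n) \<ominus> u)) \<longlonglongrightarrow> 0"
      using complete[of "\<lambda>n. d1 (X n)"] X 1 by auto
    obtain w where w: "w \<in> C" "(\<lambda>n. nm (d2 (X n) \<ominus> w)) \<longlonglongrightarrow> 0"
      using complete[of "\<lambda>n. d2 (X n)"] X 2 by auto
    have "(\<lambda>n. sqrt ((nm (d1 (X n) \<ominus> u))\<^sup>2 + (nm (d2 (X n) \<ominus> w))\<^sup>2)) \<longlonglongrightarrow> sqrt (0\<^sup>2 + 0\<^sup>2)"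
      by (intro tendsto_intros u w)
    then show "\<exists>l\<in>carrier K. (\<lambda>n. hnorm K (X n \<ominus>\<^bsub>K\<^esub> l)) \<longlonglongrightarrow> 0"
      using X u w by (intro bexI[of _ "enc u w"]) (simp_all add: K_norm)
  qed
qed (simp_all add: algebra_simps)

sublocale K: hspace K
  by unfold_locales (rule hilbert_space_K)

lemma K_nontriv: "carrier K \<noteq> {\<zero>\<^bsub>K\<^esub>}"
proof
  assume *: "carrier K = {\<zero>\<^bsub>K\<^esub>}"
  obtain x where x: "x \<in> C" "x \<noteq> \<zero>" using nontriv zero_closed by blast
  then have "enc x \<zero> = \<zero>\<^bsub>K\<^esub>" using * by (metis carrier_K enc_closed singletonD zero_closed)
  then have "d1 (enc x \<zero>) = \<zero>" by simp
  then show False using x by simp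
qed

definition dsum :: "('v \<Rightarrow> 'v) \<Rightarrow> ('v \<Rightarrow> 'v) \<Rightarrow> 'v \<Rightarrow> 'v" where
  "dsum S T = restrict (\<lambda>x. enc (S (d1 x)) (T (d2 x))) C"

lemma dsum_bop:
  assumes S: "S \<in> B" and T: "T \<in> B" shows "dsum S T \<in> bounded_ops K"
proof -
  obtain L where L: "L > 0" "\<And>x. x \<in> C \<Longrightarrow> nm (S x) \<le> L * nm x" using bop_bound[OF S] by blast
  obtain M where M: "M > 0" "\<And>x. x \<in> C \<Longrightarrow> nm (T x) \<le> M * nm x" using bop_bound[OF T] by blast
  have "restrict (\<lambda>x. enc (S (d1 x)) (T (d2 x))) (carrier K) \<in> bounded_ops K"
  proof (rule K.bopI)
    fix x assume "x \<in> carrier K"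
    then have x: "x \<in> C" by simp
    show "hnorm K (enc (S (d1 x)) (T (d2 x))) \<le> (L + M) * hnorm K x"
    proof -
      have "nm (S (d1 x)) \<le> (L + M) * nm (d1 x)" "nm (T (d2 x)) \<le> (L + M) * nm (d2 x)"
        using L(2)[of "d1 x"] M(2)[of "d2 x"] x L(1) M(1)
          mult_right_mono[of L "L + M" "nm (d1 x)"] mult_right_mono[of M "L + M" "nm (d2 x)"] by auto
      then have "(nm (S (d1 x)))\<^sup>2 + (nm (T (d2 x)))\<^sup>2 \<le> ((L + M) * nm (d1 x))\<^sup>2 + ((L + M) * nm (d2 x))\<^sup>2"
        using x S T by (intro add_mono power_mono) auto
      then have "(hnorm K (enc (S (d1 x)) (T (d2 x))))\<^sup>2 \<le> ((L + M) * hnorm K x)\<^sup>2"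
        using x S T by (simp add: K_norm_sq power_mult_distrib distrib_left)
      then show ?thesis using x L(1) M(1) K.nm_nonneg[of x] by - (rule power2_le_imp_le, simp_all)
    qed
  next
    fix x y assume "x \<in> carrier K" "y \<in> carrier K"
    then show "enc (S (d1 (x \<oplus>\<^bsub>K\<^esub> y))) (T (d2 (x \<oplus>\<^bsub>K\<^esub> y))) =
        enc (S (d1 x)) (T (d2 x)) \<oplus>\<^bsub>K\<^esub> enc (S (d1 y)) (T (d2 y))"
      using S T by - (rule double_eqI, simp_all add: bop_add)
  next
    fix c x assume "x \<in> carrier K"
    then show "enc (S (d1 (c \<odot>\<^bsub>K\<^esub> x))) (T (d2 (c \<odot>\<^bsub>K\<^esub> x))) = c \<odot>\<^bsub>K\<^esub> enc (S (d1 x)) (T (d2 x))"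
      using S T by - (rule double_eqI, simp_all add: bop_smult)
  qed (use S T in simp)
  then show ?thesis by (simp add: dsum_def)
qed

lemma dsum_apply [simp]: "x \<in> C \<Longrightarrow> dsum S T x = enc (S (d1 x)) (T (d2 x))"
  by (simp add: dsum_def)

lemma dsum_selfadjoint:
  assumes S: "selfadjoint H S" and T: "selfadjoint H T" shows "selfadjoint K (dsum S T)"
  unfolding selfadjoint_def
proof (intro conjI ballI)
  show "dsum S T \<in> bounded_ops K" using S T by (intro dsum_bop) auto
qed (use S T in \<open>simp add: sa_sym\<close>)

lemma dsum_form_ge:
  assumes S: "S \<in> B" and T: "T \<in> B"
    and "\<And>x. x \<in> C \<Longrightarrow> \<alpha> * (nm x)\<^sup>2 \<le> Re (ip (S x) x)"
    and "\<And>x. x \<in> C \<Longrightarrow> \<alpha> * (nm x)\<^sup>2 \<le> Re (ip (T x) x)"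
    and x: "x \<in> C"
  shows "\<alpha> * (hnorm K x)\<^sup>2 \<le> Re (hinner K (dsum S T x) x)"
  using assms(3)[of "d1 x"] assms(4)[of "d2 x"] S T x by (simp add: K_norm_sq distrib_left)

end

text \<open>
  A nonzero space contains the infinitely many multiples of a nonzero vector, and an infinite set is
  equinumerous with its square.
\<close>

lemma (in hspace) double_exists:
  assumes "C \<noteq> {\<zero>}" shows "\<exists>\<phi>. hspace_double H \<phi>"
proof -
  obtain x where x: "x \<in> C" "x \<noteq> \<zero>" using assms zero_closed by blast
  have "inj (\<lambda>n::nat. of_nat n \<odot> x)"
  proof (rule injI)
    fix m n :: nat assume "of_nat m \<odot> x = of_nat n \<odot> x"
    then have "of_nat m * ip x x = of_nat n * ip x x"
      using ip_smult_left[OF x(1) x(1)] by metis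
    moreover have "ip x x \<noteq> 0" using ip_self_eq_0D x by blast
    ultimately show "m = n" by simp
  qed
  then have "infinite C"
    using x by (intro infinite_super[OF _ range_inj_infinite]) auto
  then have "\<exists>\<psi>. bij_betw \<psi> (C \<times> C) C"
    using card_of_Times_same_infinite card_of_ordIso by blast
  then obtain \<phi> where "bij_betw \<phi> C (C \<times> C)" using bij_betw_inv by blast
  then show ?thesis using assms
    by (intro exI[of _ \<phi>]) unfold_locales
qed

context hspace begin

definition comb :: "real \<Rightarrow> real \<Rightarrow> ('v \<Rightarrow> 'v) \<Rightarrow> ('v \<Rightarrow> 'v) \<Rightarrow> 'v \<Rightarrow> 'v" where
  "comb b c S T = restrict (\<lambda>x. of_real b \<odot> S x \<oplus> of_real c \<odot> T x) C"

lemma comb_apply [simp]: "x \<in> C \<Longrightarrow> comb b c S T x = of_real b \<odot> S x \<oplus> of_real c \<odot> T x"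
  by (simp add: comb_def)

lemma comb_selfadjoint:
  assumes S: "selfadjoint H S" and T: "selfadjoint H T" shows "selfadjoint H (comb b c S T)"
  unfolding selfadjoint_def
proof (intro conjI ballI)
  show "comb b c S T \<in> B" unfolding comb_def using S T by (intro bop_comb) auto
qed (use S T in \<open>simp add: sa_sym\<close>)

lemma hspace_op_scalar:
  assumes "C \<noteq> {\<zero>}" "a < r" shows "hspace_op H (op_scalar H (of_real r)) a"
  by (rule hspace_opI[OF sa_scalar assms(1,2)]) (simp add: nm_sq)

lemma cfc_scalar:
  assumes "C \<noteq> {\<zero>}" "a < r" and g: "continuous_on {a<..} g" and x: "x \<in> C"
  shows "cfc H g (op_scalar H (of_real r)) x = of_real (g r) \<odot> x"
proof (rule vec_eqI)
  interpret R: hspace_op H "op_scalar H (of_real r)" a by (rule hspace_op_scalar[OF assms(1,2)])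
  obtain p where p: "approximates p g a" using approximates_exist[OF g] by blast
  show "cfc H g (op_scalar H (of_real r)) x \<in> C" using R.cfc_bop[OF p] x by simp
  fix z assume z: "z \<in> C"
  have rp: "rpoly (op_scalar H (of_real r)) q x = of_real (poly q r) \<odot> x" for q
  proof (induction q)
    case 0
    show ?case using x by (intro vec_eqI) auto
  next
    case (pCons b q)
    then show ?case using x by (intro vec_eqI) (auto simp: papp_pCons map_poly_pCons algebra_simps)
  qed
  have "uniform_limit {r..r} (\<lambda>n. poly (p n)) g sequentially"
    using p \<open>a < r\<close> unfolding approximates_def by blast
  then have "(\<lambda>n. poly (p n) r) \<longlonglongrightarrow> g r" by (rule tendsto_uniform_limitI) simp
  then have "(\<lambda>n. of_real (poly (p n) r) * ip x z) \<longlonglongrightarrow> of_real (g r) * ip x z"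
    by (intro tendsto_intros)
  then have "(\<lambda>n. ip (rpoly (op_scalar H (of_real r)) (p n) x) z) \<longlonglongrightarrow> of_real (g r) * ip x z"
    using x z by (simp add: rp)
  then show "ip (cfc H g (op_scalar H (of_real r)) x) z = ip (of_real (g r) \<odot> x) z"
    using LIMSEQ_unique[OF R.cfc_tendsto_ip[OF p x z]] x z by simp
qed (use x in simp)

lemma op_ge_iff:
  assumes S: "selfadjoint H S" and T: "selfadjoint H T"
  shows "op_ge H S T \<longleftrightarrow> (\<forall>x\<in>C. Re (ip (T x) x) \<le> Re (ip (S x) x))"
  unfolding op_ge_def op_pos_def
  by (intro ball_cong refl) (use S T in \<open>simp add: complex_nonneg_Reals_iff sa_Im\<close>)

lemma nm_sq_add_le:
  assumes "x \<in> C" "y \<in> C" shows "(nm (x \<oplus> y))\<^sup>2 \<le> 2 * (nm x)\<^sup>2 + 2 * (nm y)\<^sup>2"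
  using nm_sq_add[OF assms] nm_sq_diff[OF assms] zero_le_power2[of "nm (x \<ominus> y)"] by linarith

end

section \<open>The two-point inequality\<close>

context hspace_double begin

text \<open>
  For \<open>c\<^sup>2 + s\<^sup>2 = 1\<close> the map \<open>v \<mapsto> (c v, s v)\<close> is an isometry, \<open>coemb\<close> is its adjoint, and \<open>eproj\<close> is the
  projection onto its range.
\<close>

definition emb :: "real \<Rightarrow> real \<Rightarrow> 'v \<Rightarrow> 'v" where
  "emb c s v = enc (of_real c \<odot> v) (of_real s \<odot> v)"

definition coemb :: "real \<Rightarrow> real \<Rightarrow> 'v \<Rightarrow> 'v" where
  "coemb c s x = of_real c \<odot> d1 x \<oplus> of_real s \<odot> d2 x"

definition eproj :: "real \<Rightarrow> real \<Rightarrow> 'v \<Rightarrow> 'v" where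
  "eproj c s = restrict (\<lambda>x. emb c s (coemb c s x)) C"

lemma emb_closed [simp]: "v \<in> C \<Longrightarrow> emb c s v \<in> C"
  by (simp add: emb_def)

lemma coemb_closed [simp]: "x \<in> C \<Longrightarrow> coemb c s x \<in> C"
  by (simp add: coemb_def)

lemma d_emb [simp]:
  "v \<in> C \<Longrightarrow> d1 (emb c s v) = of_real c \<odot> v" "v \<in> C \<Longrightarrow> d2 (emb c s v) = of_real s \<odot> v"
  by (simp_all add: emb_def)

lemma eproj_apply [simp]: "x \<in> C \<Longrightarrow> eproj c s x = emb c s (coemb c s x)"
  by (simp add: eproj_def)

lemma emb_add: "\<lbrakk>v \<in> C; w \<in> C\<rbrakk> \<Longrightarrow> emb c s (v \<oplus> w) = emb c s v \<oplus>\<^bsub>K\<^esub> emb c s w"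
  by (rule double_eqI) (simp_all add: smult_add_right)

lemma emb_smult: "v \<in> C \<Longrightarrow> emb c s (b \<odot> v) = b \<odot>\<^bsub>K\<^esub> emb c s v"
  by (rule double_eqI) (simp_all add: mult.commute flip: smult_assoc)

lemma coemb_add: "\<lbrakk>x \<in> C; y \<in> C\<rbrakk> \<Longrightarrow> coemb c s (x \<oplus>\<^bsub>K\<^esub> y) = coemb c s x \<oplus> coemb c s y"
  by (rule vec_eqI) (simp_all add: coemb_def algebra_simps)

lemma coemb_smult: "x \<in> C \<Longrightarrow> coemb c s (b \<odot>\<^bsub>K\<^esub> x) = b \<odot> coemb c s x"
  by (rule vec_eqI) (simp_all add: coemb_def algebra_simps)

lemma emb_adjoint: "\<lbrakk>v \<in> C; x \<in> C\<rbrakk> \<Longrightarrow> hinner K (emb c s v) x = ip v (coemb c s x)"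
  by (simp add: coemb_def)

lemma emb_adjoint': "\<lbrakk>v \<in> C; x \<in> C\<rbrakk> \<Longrightarrow> hinner K x (emb c s v) = ip (coemb c s x) v"
  by (simp add: coemb_def)

context
  fixes c s :: real
  assumes cs: "c\<^sup>2 + s\<^sup>2 = 1"
begin

lemma coemb_emb: "v \<in> C \<Longrightarrow> coemb c s (emb c s v) = v"
proof (rule vec_eqI)
  fix z assume "v \<in> C" "z \<in> C"
  then have "ip (coemb c s (emb c s v)) z = of_real (c\<^sup>2 + s\<^sup>2) * ip v z"
    by (simp add: coemb_def power2_eq_square algebra_simps)
  then show "ip (coemb c s (emb c s v)) z = ip v z" by (simp only: cs) simp
qed simp_all

lemma hnorm_emb: "v \<in> C \<Longrightarrow> hnorm K (emb c s v) = nm v"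
  unfolding hnorm_def by (simp only: emb_adjoint coemb_emb emb_closed)

lemma orth_projection_eproj: "orth_projection K (eproj c s)"
  unfolding orth_projection_def
proof (intro conjI ballI)
  have "restrict (\<lambda>x. emb c s (coemb c s x)) (carrier K) \<in> bounded_ops K"
  proof (rule K.bopI)
    fix x assume "x \<in> carrier K"
    then have x: "x \<in> C" by simp
    have "nm (coemb c s x) \<le> \<bar>c\<bar> * nm (d1 x) + \<bar>s\<bar> * nm (d2 x)"
      using nm_triangle[of "of_real c \<odot> d1 x" "of_real s \<odot> d2 x"] x by (simp add: coemb_def nm_smult)
    also have "\<dots> \<le> \<bar>c\<bar> * hnorm K x + \<bar>s\<bar> * hnorm K x"
      using K_norm_ge[OF x] by (intro add_mono mult_left_mono) auto
    finally show "hnorm K (emb c s (coemb c s x)) \<le> (\<bar>c\<bar> + \<bar>s\<bar>) * hnorm K x"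
      using x by (simp add: hnorm_emb algebra_simps)
  qed (simp_all add: coemb_add coemb_smult emb_add emb_smult)
  then have "eproj c s \<in> bounded_ops K" by (simp add: eproj_def)
  moreover have "hinner K (eproj c s x) y = hinner K x (eproj c s y)" if "x \<in> C" "y \<in> C" for x y
    using that by (simp del: K_inner add: emb_adjoint emb_adjoint')
  ultimately show "selfadjoint K (eproj c s)" unfolding selfadjoint_def by simp
  show "eproj c s (eproj c s x) = eproj c s x" if "x \<in> carrier K" for x
    using that by (simp add: coemb_emb)
qed

text \<open>
  The defining inequality of strong operator convexity for the diagonal operator \<open>S \<oplus> T\<close> and the
  projection onto the vectors \<open>(c v, s v)\<close>, evaluated at the vector \<open>(u, w)\<close>.
\<close>

lemma SOC_two_point:
  assumes g: "g \<in> SOC TYPE('v) {a<..}"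
    and S: "hspace_op H S a" and T: "hspace_op H T a"
    and u: "u \<in> C" and w: "w \<in> C"
  shows "Re (ip (cfc H g (comb (c\<^sup>2) (s\<^sup>2) S T) (of_real c \<odot> u \<oplus> of_real s \<odot> w))
          (of_real c \<odot> u \<oplus> of_real s \<odot> w))
        \<le> Re (ip (cfc H g S u) u) + Re (ip (cfc H g T w) w)"
proof -
  interpret S: hspace_op H S a by (rule S)
  interpret T: hspace_op H T a by (rule T)
  have cont: "continuous_on {a<..} g" using g by (simp add: SOC_def)
  obtain p where p: "approximates p g a" using approximates_exist[OF cont] by blast
  obtain \<alpha>1 where \<alpha>1: "a < \<alpha>1" "\<And>x. x \<in> C \<Longrightarrow> \<alpha>1 * (nm x)\<^sup>2 \<le> Re (ip (S x) x)"
    using S.form_gt by blast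
  obtain \<alpha>2 where \<alpha>2: "a < \<alpha>2" "\<And>x. x \<in> C \<Longrightarrow> \<alpha>2 * (nm x)\<^sup>2 \<le> Re (ip (T x) x)"
    using T.form_gt by blast
  define \<alpha> where "\<alpha> = min \<alpha>1 \<alpha>2"
  have \<alpha>: "a < \<alpha>" using \<alpha>1(1) \<alpha>2(1) by (simp add: \<alpha>_def)
  have S_ge: "\<alpha> * (nm x)\<^sup>2 \<le> Re (ip (S x) x)" if "x \<in> C" for x
    using \<alpha>1(2)[OF that] mult_right_mono[of \<alpha> \<alpha>1 "(nm x)\<^sup>2"] by (simp add: \<alpha>_def)
  have T_ge: "\<alpha> * (nm x)\<^sup>2 \<le> Re (ip (T x) x)" if "x \<in> C" for x
    using \<alpha>2(2)[OF that] mult_right_mono[of \<alpha> \<alpha>2 "(nm x)\<^sup>2"] by (simp add: \<alpha>_def)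
  define M where "M = comb (c\<^sup>2) (s\<^sup>2) S T"
  have Mop: "hspace_op H (comb (c\<^sup>2) (s\<^sup>2) S T) a"
  proof (rule hspace_opI[OF comb_selfadjoint[OF S.sa T.sa] nontriv \<alpha>])
    fix x assume x: "x \<in> C"
    have "\<alpha> * (nm x)\<^sup>2 = c\<^sup>2 * (\<alpha> * (nm x)\<^sup>2) + s\<^sup>2 * (\<alpha> * (nm x)\<^sup>2)"
      using cs by (simp flip: distrib_right)
    also have "\<dots> \<le> c\<^sup>2 * Re (ip (S x) x) + s\<^sup>2 * Re (ip (T x) x)"
      using S_ge[OF x] T_ge[OF x] by (intro add_mono mult_left_mono) auto
    finally show "\<alpha> * (nm x)\<^sup>2 \<le> Re (ip (comb (c\<^sup>2) (s\<^sup>2) S T x) x)"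
      using x by (simp flip: of_real_power)
  qed
  let ?D = "dsum S T"
  have D_sa: "selfadjoint K ?D" using S.sa T.sa by (rule dsum_selfadjoint)
  have D_ge: "\<alpha> * (hnorm K x)\<^sup>2 \<le> Re (hinner K (?D x) x)" if "x \<in> carrier K" for x
    using that S_ge T_ge by (intro dsum_form_ge) auto
  have Dop: "hspace_op K ?D a" by (rule K.hspace_opI[OF D_sa K_nontriv \<alpha> D_ge])
  interpret D: hspace_op K ?D a by (rule Dop)
  interpret P: hspace_proj K "eproj c s" by unfold_locales (rule orth_projection_eproj)
  have emb_R: "emb c s v \<in> carrier P.R" if "v \<in> C" for v
    using that by (simp add: P.carrier_R coemb_emb)
  have R_nontriv: "carrier P.R \<noteq> {\<zero>\<^bsub>K\<^esub>}"
  proof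
    assume *: "carrier P.R = {\<zero>\<^bsub>K\<^esub>}"
    have "v = \<zero>" if v: "v \<in> C" for v
    proof -
      have "emb c s v = \<zero>\<^bsub>K\<^esub>" using * emb_R[OF v] by blast
      then have "coemb c s (emb c s v) = coemb c s \<zero>\<^bsub>K\<^esub>" by simp
      also have "\<dots> = \<zero>" unfolding coemb_def by (rule vec_eqI) simp_all
      finally show ?thesis using v by (simp add: coemb_emb)
    qed
    then show False using nontriv zero_closed by blast
  qed
  have Rop: "hspace_op P.R (compression K (eproj c s) ?D) a"
    by (rule P.hspace_op_compression[OF D_sa R_nontriv \<alpha> D_ge])
  \<comment> \<open>On the vectors \<open>(c v, s v)\<close> the compression of \<open>S \<oplus> T\<close> acts as \<open>c\<^sup>2 S + s\<^sup>2 T\<close> acts on \<open>v\<close>.\<close>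
  have embM: "emb c s (cfc H g M v) = cfc P.R g (compression K (eproj c s) ?D) (emb c s v)"
    if v: "v \<in> C" for v
  proof (rule cfc_intertwine[OF Mop[folded M_def] Rop])
    fix y assume y: "y \<in> C"
    have "compression K (eproj c s) ?D (emb c s y) = eproj c s (?D (eproj c s (emb c s y)))"
      using emb_R[OF y] by (simp add: compression_def range_space_def)
    also have "\<dots> = emb c s (coemb c s (?D (emb c s y)))"
      using y by (simp add: coemb_emb)
    also have "coemb c s (?D (emb c s y)) = M y"
      using y unfolding M_def coemb_def
      by (intro vec_eqI) (simp_all add: bop_smult power2_eq_square)
    finally show "emb c s (M y) = compression K (eproj c s) ?D (emb c s y)" by simp
    show "hnorm P.R (emb c s y) \<le> 1 * nm y" using y by (simp add: hnorm_emb)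
  qed (use v cont emb_R in \<open>simp_all add: emb_add emb_smult\<close>)
  have d1_cfc: "d1 (cfc K g ?D x) = cfc H g S (d1 x)" if x: "x \<in> C" for x
    by (rule cfc_intertwine[OF Dop S, of d1 1]) (use x cont K_norm_ge in simp_all)
  have d2_cfc: "d2 (cfc K g ?D x) = cfc H g T (d2 x)" if x: "x \<in> C" for x
    by (rule cfc_intertwine[OF Dop T, of d2 1]) (use x cont K_norm_ge in simp_all)
  define x where "x = enc u w"
  define v where "v = of_real c \<odot> u \<oplus> of_real s \<odot> w"
  have x: "x \<in> C" "d1 x = u" "d2 x = w" using u w by (simp_all add: x_def)
  have v: "v \<in> C" "coemb c s x = v" using u w x by (simp_all add: v_def coemb_def)
  have cM: "cfc H g M v \<in> C"
    using hspace_op.cfc_bop[OF Mop p] v by (simp add: M_def)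
  have "op_ge K (cfc K g ?D) (cfc_compression K g (eproj c s) ?D)"
    using g hilbert_space_K D_sa D.spec orth_projection_eproj unfolding SOC_def by blast
  then have "0 \<le> Re (hinner K (op_diff K (cfc K g ?D) (cfc_compression K g (eproj c s) ?D) x) x)"
    using x unfolding op_ge_def op_pos_def complex_nonneg_Reals_iff carrier_K by blast
  moreover have "cfc_compression K g (eproj c s) ?D x = emb c s (cfc H g M v)"
    using x v embM[OF v(1)] by (simp add: cfc_compression_def)
  moreover have "hinner K (cfc K g ?D x) x = ip (cfc H g S u) u + ip (cfc H g T w) w"
    using x d1_cfc d2_cfc by simp
  moreover have "hinner K (emb c s (cfc H g M v)) x = ip (cfc H g M v) v"
    using x v cM by (simp only: emb_adjoint)
  moreover have "cfc K g ?D x \<in> carrier K" using K.bop_closed[OF D.cfc_bop[OF p]] x by simp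
  ultimately have "0 \<le> Re (ip (cfc H g S u) u + ip (cfc H g T w) w - ip (cfc H g M v) v)"
    using x cM by (simp del: K_inner add: K.op_diff_apply)
  then show "Re (ip (cfc H g (comb (c\<^sup>2) (s\<^sup>2) S T) (of_real c \<odot> u \<oplus> of_real s \<odot> w))
          (of_real c \<odot> u \<oplus> of_real s \<odot> w))
        \<le> Re (ip (cfc H g S u) u) + Re (ip (cfc H g T w) w)"
    by (simp add: M_def v_def)
qed

end

end

section \<open>Consequences of strong operator convexity\<close>

lemma SOC_continuous: "g \<in> SOC TYPE('v) J \<Longrightarrow> continuous_on J g"
  by (simp add: SOC_def)

context hspace begin

text \<open>
  The operator \<open>U = S + (T - S) / e\<close> lies above \<open>S\<close>, and \<open>T\<close> is its mean with \<open>S\<close> for the weights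
  \<open>c\<^sup>2 = 1 - e\<close>, \<open>s\<^sup>2 = e\<close>. With \<open>u = x\<close>, \<open>w = 0\<close> the two-point inequality reads \<open>(1 - e) g(T) \<le> g(S)\<close>, and \<open>e\<close>
  tends to 0.
\<close>

lemma SOC_antimono:
  assumes g: "g \<in> SOC TYPE('v) {a<..}"
    and S: "hspace_op H S a" and T: "hspace_op H T a"
    and le: "\<And>x. x \<in> C \<Longrightarrow> Re (ip (S x) x) \<le> Re (ip (T x) x)"
    and x: "x \<in> C"
  shows "Re (ip (cfc H g T x) x) \<le> Re (ip (cfc H g S x) x)"
proof -
  interpret S: hspace_op H S a by (rule S)
  interpret T: hspace_op H T a by (rule T)
  obtain \<phi> where "hspace_double H \<phi>" using double_exists[OF S.nontriv] by blast
  then interpret dbl: hspace_double H \<phi> .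
  obtain p where p: "approximates p g a" using approximates_exist[OF SOC_continuous[OF g]] by blast
  obtain \<alpha> where \<alpha>: "a < \<alpha>" "\<And>x. x \<in> C \<Longrightarrow> \<alpha> * (nm x)\<^sup>2 \<le> Re (ip (S x) x)"
    using S.form_gt by blast
  have step: "(1 - e) * Re (ip (cfc H g T x) x) \<le> Re (ip (cfc H g S x) x)" if e: "0 < e" "e < 1" for e
  proof -
    define U where "U = comb (1 - 1 / e) (1 / e) S T"
    have U: "hspace_op H U a"
    proof (rule hspace_opI[OF _ S.nontriv \<alpha>(1)])
      show "selfadjoint H U" unfolding U_def by (rule comb_selfadjoint[OF S.sa T.sa])
      fix y assume y: "y \<in> C"
      have "Re (ip (U y) y) = Re (ip (S y) y) + (Re (ip (T y) y) - Re (ip (S y) y)) / e"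
        using y e by (simp add: U_def field_simps)
      moreover have "0 \<le> (Re (ip (T y) y) - Re (ip (S y) y)) / e" using le[OF y] e by simp
      ultimately show "\<alpha> * (nm y)\<^sup>2 \<le> Re (ip (U y) y)" using \<alpha>(2)[OF y] by linarith
    qed
    define c where "c = sqrt (1 - e)"
    define s where "s = sqrt e"
    have c2: "c\<^sup>2 = 1 - e" and s2: "s\<^sup>2 = e" using e by (simp_all add: c_def s_def)
    have cs: "c\<^sup>2 + s\<^sup>2 = 1" by (simp add: c2 s2)
    have T_eq: "comb (c\<^sup>2) (s\<^sup>2) S U = T"
    proof (rule bop_ext)
      show "comb (c\<^sup>2) (s\<^sup>2) S U \<in> B"
        using comb_selfadjoint[OF S.sa hspace_op.sa[OF U]] by simp
      fix y assume y: "y \<in> C"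
      show "comb (c\<^sup>2) (s\<^sup>2) S U y = T y"
      proof (rule vec_eqI)
        fix z assume z: "z \<in> C"
        have "ip (comb (c\<^sup>2) (s\<^sup>2) S U y) z =
            of_real ((1 - e) + e * (1 - 1 / e)) * ip (S y) z + of_real (e * (1 / e)) * ip (T y) z"
          unfolding c2 s2 U_def using y z by (simp add: algebra_simps)
        also have "\<dots> = ip (T y) z" using e by (simp add: field_simps)
        finally show "ip (comb (c\<^sup>2) (s\<^sup>2) S U y) z = ip (T y) z" .
      qed (use y U_def in simp_all)
    qed simp
    have cTx: "cfc H g T x \<in> C" and cU0: "cfc H g U \<zero> = \<zero>"
      using x T.cfc_bop[OF p] hspace_op.cfc_bop[OF U p] by (simp_all add: bop_zero)
    have v: "of_real c \<odot> x \<oplus> of_real s \<odot> \<zero> = of_real c \<odot> x"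
      using x by (intro vec_eqI) simp_all
    have "Re (ip (cfc H g T (of_real c \<odot> x)) (of_real c \<odot> x)) \<le> Re (ip (cfc H g S x) x)"
      using dbl.SOC_two_point[OF cs g S U x zero_closed] unfolding T_eq v cU0 by simp
    moreover have "Re (ip (cfc H g T (of_real c \<odot> x)) (of_real c \<odot> x)) = c\<^sup>2 * Re (ip (cfc H g T x) x)"
      using x cTx T.cfc_bop[OF p] by (simp add: bop_smult power2_eq_square)
    ultimately show ?thesis by (simp add: c2)
  qed
  show ?thesis
  proof (rule tendsto_upperbound)
    show "((\<lambda>e. (1 - e) * Re (ip (cfc H g T x) x)) \<longlongrightarrow> Re (ip (cfc H g T x) x)) (at_right 0)"
      by (auto intro!: tendsto_eq_intros)
    show "\<forall>\<^sub>F e in at_right 0. (1 - e) * Re (ip (cfc H g T x) x) \<le> Re (ip (cfc H g S x) x)"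
      using step by (auto simp: eventually_at_right_field intro!: exI[of _ 1])
  qed simp
qed

context
  fixes g a
  assumes nontriv: "C \<noteq> {\<zero>}" and g: "g \<in> SOC TYPE('v) {a<..}"
begin

lemma nonzero_vector: obtains v where "v \<in> C" "0 < (nm v)\<^sup>2"
proof -
  obtain v where "v \<in> C" "v \<noteq> \<zero>" using nontriv zero_closed by blast
  then show ?thesis using that[of v] by simp
qed

lemma cfc_scalar_form:
  assumes "a < r" "x \<in> C"
  shows "Re (ip (cfc H g (op_scalar H (of_real r)) x) x) = g r * (nm x)\<^sup>2"
  using cfc_scalar[OF nontriv assms(1) SOC_continuous[OF g] assms(2)] assms(2) by (simp add: nm_sq)

lemma SOC_antimono_scalar:
  assumes "a < r" "r \<le> t" shows "g t \<le> g r"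
proof -
  obtain v where v: "v \<in> C" "0 < (nm v)\<^sup>2" by (rule nonzero_vector)
  have "a < t" using assms by simp
  have "Re (ip (cfc H g (op_scalar H (of_real t)) v) v) \<le> Re (ip (cfc H g (op_scalar H (of_real r)) v) v)"
    using hspace_op_scalar[OF nontriv assms(1)] hspace_op_scalar[OF nontriv \<open>a < t\<close>]
    by (rule SOC_antimono[OF g _ _ _ v(1)]) (use assms in \<open>simp add: Re_ip_self_nonneg mult_right_mono\<close>)
  then show ?thesis using v assms(1) \<open>a < t\<close> by (simp add: cfc_scalar_form)
qed

text \<open>
  The two-point inequality for scalar operators, evaluated at a pair \<open>(c v, s v)\<close> in the range of the projection.
\<close>

lemma SOC_convex: "convex_on {a<..} g"
proof (rule convex_onI)
  fix t x y :: real assume t: "0 < t" "t < 1" and xy: "x \<in> {a<..}" "y \<in> {a<..}"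
  obtain v where v: "v \<in> C" "0 < (nm v)\<^sup>2" by (rule nonzero_vector)
  obtain \<phi> where "hspace_double H \<phi>" using double_exists[OF nontriv] by blast
  then interpret dbl: hspace_double H \<phi> .
  define c where "c = sqrt (1 - t)"
  define s where "s = sqrt t"
  have c2: "c\<^sup>2 = 1 - t" and s2: "s\<^sup>2 = t" using t by (simp_all add: c_def s_def)
  have cs: "c\<^sup>2 + s\<^sup>2 = 1" by (simp add: c2 s2)
  define r where "r = (1 - t) * x + t * y"
  have "0 < (1 - t) * (x - a) + t * (y - a)" using t xy by (intro add_pos_pos) simp_all
  then have "a < r" by (simp add: r_def algebra_simps)
  let ?X = "op_scalar H (of_real x)" and ?Y = "op_scalar H (of_real y)"
  have X: "hspace_op H ?X a" "hspace_op H ?Y a" using xy hspace_op_scalar[OF nontriv] by simp_all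
  have eq: "comb (c\<^sup>2) (s\<^sup>2) ?X ?Y = op_scalar H (of_real r)"
  proof (rule bop_ext)
    show "comb (c\<^sup>2) (s\<^sup>2) ?X ?Y \<in> B" using comb_selfadjoint[OF sa_scalar sa_scalar] by simp
    fix y' assume "y' \<in> C"
    then show "comb (c\<^sup>2) (s\<^sup>2) ?X ?Y y' = op_scalar H (of_real r) y'"
      unfolding c2 s2 r_def by (intro vec_eqI) (simp_all add: algebra_simps)
  qed simp
  have v_eq: "of_real c \<odot> (of_real c \<odot> v) \<oplus> of_real s \<odot> (of_real s \<odot> v) = v"
    using dbl.coemb_emb[OF cs v(1)] v by (simp add: dbl.coemb_def)
  have "g r * (nm v)\<^sup>2 \<le> g x * (c\<^sup>2 * (nm v)\<^sup>2) + g y * (s\<^sup>2 * (nm v)\<^sup>2)"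
    using dbl.SOC_two_point[OF cs g X, of "of_real c \<odot> v" "of_real s \<odot> v"] v xy \<open>a < r\<close>
    unfolding eq v_eq by (simp add: cfc_scalar_form nm_smult power_mult_distrib)
  also have "\<dots> = ((1 - t) * g x + t * g y) * (nm v)\<^sup>2" by (simp add: c2 s2 algebra_simps)
  finally show "g ((1 - t) *\<^sub>R x + t *\<^sub>R y) \<le> (1 - t) * g x + t * g y"
    using v(2) by (simp add: r_def)
qed simp

text \<open>
  Suppose that \<open>x0 < y\<close>. On pairs of vectors let \<open>T\<close> be the diagonal operator with entries \<open>x0\<close> and \<open>2 y - x1\<close>, where
  \<open>x1 < x0\<close>, and let \<open>S\<close> have the eigenvalue \<open>y\<close> on the pairs \<open>(\<sigma> v, \<gamma> v)\<close> and the eigenvalue \<open>x1\<close>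
  on their complement. If these pairs are tilted only slightly towards the first coordinate, then \<open>S \<le> T\<close>, so
  that \<open>g(T) \<le> g(S)\<close>. At \<open>(\<sigma> v, \<gamma> v)\<close>, for a unit vector \<open>v\<close>, the form of \<open>g(S)\<close> is \<open>k\<close>, and that of \<open>g(T)\<close> is
  \<open>\<sigma>\<^sup>2 g x0 + \<gamma>\<^sup>2 k\<close>; this leaves \<open>g x0 \<le> k\<close>.
\<close>

lemma SOC_constant_ray:
  assumes "a < y" and k: "\<And>z. y \<le> z \<Longrightarrow> g z = k" and "a < x0"
  shows "g x0 \<le> k"
proof (cases "x0 < y")
  case True
  obtain v where v: "v \<in> C" "0 < (nm v)\<^sup>2" by (rule nonzero_vector)
  obtain \<phi> where "hspace_double H \<phi>" using double_exists[OF nontriv] by blast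
  then interpret dbl: hspace_double H \<phi> .
  note cont = SOC_continuous[OF g]
  obtain x1 where x1: "a < x1" "x1 < x0" using dense[OF \<open>a < x0\<close>] by blast
  \<comment> \<open>By \<open>|\<sigma> p + \<gamma> q|\<^sup>2 \<le> 2 \<sigma>\<^sup>2 |p|\<^sup>2 + 2 |q|\<^sup>2\<close>, the form of \<open>S\<close> has at most the coefficients
    \<open>x1 + 2 (y - x1) \<sigma>\<^sup>2\<close> and \<open>x1 + 2 (y - x1)\<close>; the tilt \<open>\<sigma>\<close> is chosen so that the first one is \<open>x0\<close>.\<close>
  define \<sigma> where "\<sigma> = sqrt ((x0 - x1) / (2 * (y - x1)))"
  define \<gamma> where "\<gamma> = sqrt (1 - (x0 - x1) / (2 * (y - x1)))"
  have q: "0 < (x0 - x1) / (2 * (y - x1))" "(x0 - x1) / (2 * (y - x1)) < 1"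
    using x1 True by (simp_all add: field_simps)
  have \<sigma>2: "\<sigma>\<^sup>2 = (x0 - x1) / (2 * (y - x1))" and \<gamma>2: "\<gamma>\<^sup>2 = 1 - \<sigma>\<^sup>2"
    using q by (simp_all add: \<sigma>_def \<gamma>_def)
  have cs: "\<sigma>\<^sup>2 + \<gamma>\<^sup>2 = 1" by (simp add: \<gamma>2)
  have \<gamma>1: "\<gamma>\<^sup>2 \<le> 1" by (simp add: \<gamma>2)
  let ?K = "dbl.K"
  define Q where "Q = dbl.eproj \<sigma> \<gamma>"
  have Q_sa: "selfadjoint ?K Q"
    using dbl.orth_projection_eproj[OF cs] by (simp add: Q_def orth_projection_def)
  define S where "S = dbl.K.comb x1 (y - x1) (op_scalar ?K (of_real 1)) Q"
  define T where "T = dbl.dsum (op_scalar H (of_real x0)) (op_scalar H (of_real (2 * y - x1)))"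
  have S_sa: "selfadjoint ?K S"
    unfolding S_def by (rule dbl.K.comb_selfadjoint[OF dbl.K.sa_scalar Q_sa])
  have S_form: "Re (hinner ?K (S x) x) = x1 * (hnorm ?K x)\<^sup>2 + (y - x1) * (nm (dbl.coemb \<sigma> \<gamma> x))\<^sup>2"
    if x: "x \<in> C" for x
  proof -
    have "hinner ?K (Q x) x = ip (dbl.coemb \<sigma> \<gamma> x) (dbl.coemb \<sigma> \<gamma> x)"
      unfolding Q_def using x dbl.emb_adjoint[of "dbl.coemb \<sigma> \<gamma> x" x \<sigma> \<gamma>] by simp
    moreover have "Q x \<in> C" unfolding Q_def using x by simp
    ultimately show ?thesis
      using x unfolding S_def
      by (simp del: dbl.K_inner add: dbl.K.nm_sq nm_sq)
  qed
  have T_form: "Re (hinner ?K (T x) x) = x0 * (nm (dbl.d1 x))\<^sup>2 + (2 * y - x1) * (nm (dbl.d2 x))\<^sup>2"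
    if x: "x \<in> C" for x
    using x by (simp add: T_def nm_sq)
  have S_op: "hspace_op ?K S a"
    by (rule dbl.K.hspace_opI[OF S_sa dbl.K_nontriv x1(1)]) (use S_form x1 True in simp)
  have T_op: "hspace_op ?K T a"
  proof (rule dbl.K.hspace_opI[OF _ dbl.K_nontriv \<open>a < x0\<close>])
    show "selfadjoint ?K T" unfolding T_def by (rule dbl.dsum_selfadjoint) (rule sa_scalar)+
    fix x assume "x \<in> carrier ?K"
    then show "x0 * (hnorm ?K x)\<^sup>2 \<le> Re (hinner ?K (T x) x)"
      using T_form[of x] mult_right_mono[of x0 "2 * y - x1" "(nm (dbl.d2 x))\<^sup>2"] True x1
      by (simp add: dbl.K_norm_sq distrib_left)
  qed
  have le: "Re (hinner ?K (S x) x) \<le> Re (hinner ?K (T x) x)" if "x \<in> carrier ?K" for x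
  proof -
    have x: "x \<in> C" using that by simp
    have "(nm (dbl.coemb \<sigma> \<gamma> x))\<^sup>2 \<le> 2 * (\<sigma>\<^sup>2 * (nm (dbl.d1 x))\<^sup>2) + 2 * (\<gamma>\<^sup>2 * (nm (dbl.d2 x))\<^sup>2)"
      using nm_sq_add_le[of "of_real \<sigma> \<odot> dbl.d1 x" "of_real \<gamma> \<odot> dbl.d2 x"] x
      by (simp add: dbl.coemb_def nm_smult power_mult_distrib)
    also have "\<dots> \<le> 2 * (\<sigma>\<^sup>2 * (nm (dbl.d1 x))\<^sup>2) + 2 * (1 * (nm (dbl.d2 x))\<^sup>2)"
      using \<gamma>1 by (intro add_left_mono mult_left_mono mult_right_mono) auto
    finally have "(y - x1) * (nm (dbl.coemb \<sigma> \<gamma> x))\<^sup>2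
        \<le> (y - x1) * (2 * (\<sigma>\<^sup>2 * (nm (dbl.d1 x))\<^sup>2) + 2 * (1 * (nm (dbl.d2 x))\<^sup>2))"
      using True x1 by (intro mult_left_mono) auto
    also have "\<dots> = (2 * (y - x1) * \<sigma>\<^sup>2) * (nm (dbl.d1 x))\<^sup>2 + 2 * (y - x1) * (nm (dbl.d2 x))\<^sup>2"
      by (simp add: algebra_simps)
    also have "2 * (y - x1) * \<sigma>\<^sup>2 = x0 - x1" using True x1 by (simp add: \<sigma>2 field_simps)
    finally show ?thesis
      unfolding S_form[OF x] T_form[OF x] using x by (simp add: dbl.K_norm_sq algebra_simps)
  qed
  define e where "e = dbl.emb \<sigma> \<gamma> v"
  have e: "e \<in> C" using v by (simp add: e_def)
  have "cfc ?K g S e = dbl.emb \<sigma> \<gamma> (cfc H g (op_scalar H (of_real y)) v)"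
    unfolding e_def
  proof (rule cfc_intertwine[OF hspace_op_scalar[OF nontriv \<open>a < y\<close>] S_op, symmetric])
    fix x assume x: "x \<in> C"
    have ex: "dbl.emb \<sigma> \<gamma> x \<in> C" using x by simp
    have "S (dbl.emb \<sigma> \<gamma> x) = of_real y \<odot>\<^bsub>?K\<^esub> dbl.emb \<sigma> \<gamma> x"
      using ex x dbl.coemb_emb[OF cs x] unfolding S_def Q_def
      by (intro dbl.K.vec_eqI) (simp_all del: dbl.K_inner add: algebra_simps)
    then show "dbl.emb \<sigma> \<gamma> (op_scalar H (of_real y) x) = S (dbl.emb \<sigma> \<gamma> x)"
      using x by (simp add: dbl.emb_smult)
    show "hnorm ?K (dbl.emb \<sigma> \<gamma> x) \<le> 1 * nm x" using x by (simp add: dbl.hnorm_emb[OF cs])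
  qed (use v cont in \<open>simp_all add: dbl.emb_add dbl.emb_smult\<close>)
  also have "\<dots> = of_real k \<odot>\<^bsub>?K\<^esub> e"
    using v by (simp add: cfc_scalar[OF nontriv \<open>a < y\<close> cont] k e_def dbl.emb_smult)
  finally have gS: "Re (hinner ?K (cfc ?K g S e) e) = k * (nm v)\<^sup>2"
    using e v dbl.hnorm_emb[OF cs v(1)] by (simp del: dbl.K_inner add: dbl.K.nm_sq[symmetric]) (simp add: e_def)
  have y2: "a < 2 * y - x1" "g (2 * y - x1) = k" using x1 True \<open>a < y\<close> by (auto intro!: k)
  have "dbl.d1 (cfc ?K g T e) = cfc H g (op_scalar H (of_real x0)) (dbl.d1 e)"
    by (rule cfc_intertwine[OF T_op hspace_op_scalar[OF nontriv \<open>a < x0\<close>], of dbl.d1 1])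
      (use e cont dbl.K_norm_ge in \<open>simp_all add: T_def\<close>)
  then have "dbl.d1 (cfc ?K g T e) = of_real (g x0) \<odot> dbl.d1 e"
    using e cfc_scalar[OF nontriv \<open>a < x0\<close> cont] by simp
  moreover have "dbl.d2 (cfc ?K g T e) = cfc H g (op_scalar H (of_real (2 * y - x1))) (dbl.d2 e)"
    by (rule cfc_intertwine[OF T_op hspace_op_scalar[OF nontriv y2(1)], of dbl.d2 1])
      (use e cont dbl.K_norm_ge in \<open>simp_all add: T_def\<close>)
  then have "dbl.d2 (cfc ?K g T e) = of_real k \<odot> dbl.d2 e"
    using e cfc_scalar[OF nontriv y2(1) cont] y2(2) by simp
  ultimately have "Re (hinner ?K (cfc ?K g T e) e) = g x0 * (\<sigma>\<^sup>2 * (nm v)\<^sup>2) + k * (\<gamma>\<^sup>2 * (nm v)\<^sup>2)"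
    using v(1) unfolding nm_sq[OF v(1)] by (simp add: e_def power2_eq_square)
  then have "g x0 * (\<sigma>\<^sup>2 * (nm v)\<^sup>2) + k * (\<gamma>\<^sup>2 * (nm v)\<^sup>2) \<le> k * (nm v)\<^sup>2"
    using dbl.K.SOC_antimono[OF g S_op T_op le, of e] e gS by simp
  then have "g x0 * (\<sigma>\<^sup>2 * (nm v)\<^sup>2) \<le> k * (\<sigma>\<^sup>2 * (nm v)\<^sup>2)"
    by (simp add: \<gamma>2 algebra_simps)
  moreover have "0 < \<sigma>\<^sup>2 * (nm v)\<^sup>2" unfolding \<sigma>2 using q(1) v(2) by (rule mult_pos_pos)
  ultimately show ?thesis by (simp add: mult_le_cancel_right)
qed (use k in simp)

text \<open>
  If \<open>g x = g y\<close>, then convexity keeps \<open>g\<close> from falling below this value to the right of \<open>y\<close>, so \<open>g\<close> is constant on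
  \<open>[x, \<infinity>)\<close>, and \<open>SOC_constant_ray\<close> extends this to the whole interval.
\<close>

lemma SOC_strict_antimono:
  assumes nonconst: "\<not> g constant_on {a<..}" and "a < x" "x < y"
  shows "g y < g x"
proof (rule ccontr)
  assume "\<not> g y < g x"
  then have xy: "g y = g x" using SOC_antimono_scalar[of x y] assms by simp
  have ray: "g z = g x" if "x \<le> z" for z
  proof (cases "z \<le> y")
    case True
    then show ?thesis using SOC_antimono_scalar[of x z] SOC_antimono_scalar[of z y] that assms xy by simp
  next
    case False
    define t where "t = (y - x) / (z - x)"
    have t: "0 < t" "t < 1" using False assms by (simp_all add: t_def field_simps)
    have "(1 - t) * x + t * z = x + t * (z - x)" by (simp add: algebra_simps)
    also have "\<dots> = y" using False assms by (simp add: t_def)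
    finally have "g y \<le> (1 - t) * g x + t * g z"
      using convex_onD[OF SOC_convex, of t x z] t assms that by simp
    then have "t * g x \<le> t * g z" using xy by (simp add: algebra_simps)
    then show ?thesis using t SOC_antimono_scalar[of x z] that assms by (simp add: mult_le_cancel_left)
  qed
  have "g z = g x" if "z \<in> {a<..}" for z
  proof -
    have "g z \<le> g x" using SOC_constant_ray[OF \<open>a < x\<close> ray] that by simp
    moreover have "g x \<le> g z" using ray[of z] SOC_antimono_scalar[of z x] that by (cases "x \<le> z") auto
    ultimately show ?thesis by simp
  qed
  then show False using nonconst unfolding constant_on_def by blast
qed

text \<open>
  The points \<open>x + m\<close> and \<open>y\<close> lie between \<open>x\<close> and \<open>y + m\<close> and are convex combinations of them with the
  weights interchanged; adding the two convexity inequalities gives the claim.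
\<close>

lemma SOC_increment_mono:
  assumes "a < x" "x \<le> y" "0 \<le> m"
  shows "g y - g (y + m) \<le> g x - g (x + m)"
proof (cases "x = y \<or> m = 0")
  case False
  define t where "t = m / (y + m - x)"
  have t: "0 < t" "t < 1" using False assms by (simp_all add: t_def field_simps)
  have td: "t * (y + m - x) = m" using False assms by (simp add: t_def)
  have "g ((1 - t) * x + t * (y + m)) \<le> (1 - t) * g x + t * g (y + m)"
    using convex_onD[OF SOC_convex, of t x "y + m"] t assms by simp
  moreover have "g (t * x + (1 - t) * (y + m)) \<le> t * g x + (1 - t) * g (y + m)"
    using convex_onD[OF SOC_convex, of "1 - t" x "y + m"] t assms by simp
  moreover have "(1 - t) * x + t * (y + m) = x + m" "t * x + (1 - t) * (y + m) = y"
    using td by (simp_all add: algebra_simps)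
  ultimately show ?thesis by (simp add: algebra_simps)
qed auto

end

end

section \<open>Shifting an operator by a scalar\<close>

context hspace_op begin

lemma rpoly_shift:
  assumes x: "x \<in> C"
  shows "rpoly (op_diff H T (op_scalar H (of_real (- m)))) p x = rpoly T (pcompose p [:m, 1:]) x"
proof (induction p)
  case (pCons b p)
  let ?v = "rpoly T (pcompose p [:m, 1:]) x"
  have v: "?v \<in> C" using x by simp
  have "map_poly complex_of_real ([:b:] + [:m, 1:] * pcompose p [:m, 1:]) =
      [:of_real b:] + [:of_real m, 1:] * map_poly of_real (pcompose p [:m, 1:])"
    by (intro poly_eqI) (simp add: coeff_map_poly coeff_pCons split: nat.split)
  then have "rpoly T (pcompose (pCons b p) [:m, 1:]) x = of_real b \<odot> x \<oplus> (of_real m \<odot> ?v \<oplus> T ?v)"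
    using x v smult_one[OF v]
    by (simp only: pcompose_pCons papp_add papp_mult papp_const papp_pCons[of T _ "of_real m" "[:1:]"] T_bop)
  also have "\<dots> = rpoly (op_diff H T (op_scalar H (of_real (- m)))) (pCons b p) x"
    using x v pCons.IH by (intro vec_eqI) (simp_all add: papp_pCons map_poly_pCons)
  finally show ?case by simp
qed simp

text \<open>
  The operator \<open>g(T) - g(T + m)\<close> is the limit of \<open>q\<^sub>n(T)\<close>, where \<open>q\<^sub>n t = p\<^sub>n t - p\<^sub>n (t + m)\<close> converges uniformly on
  the spectrum of \<open>T\<close> to \<open>g t - g (t + m)\<close>, so that \<open>rpoly_form_ge\<close> applies with \<open>\<kappa> - e\<close>.
\<close>

lemma cfc_shift_form:
  assumes g: "continuous_on {a<..} g" and "0 \<le> m"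
    and shift: "hspace_op H (op_diff H T (op_scalar H (of_real (- m)))) a"
    and \<kappa>: "\<And>t. t \<in> spr T \<Longrightarrow> \<kappa> \<le> g t - g (t + m)"
    and x: "x \<in> C"
  shows "\<kappa> * (nm x)\<^sup>2 \<le> Re (ip (cfc H g T x) x)
    - Re (ip (cfc H g (op_diff H T (op_scalar H (of_real (- m)))) x) x)"
proof -
  let ?U = "op_diff H T (op_scalar H (of_real (- m)))"
  interpret U: hspace_op H ?U a by (rule shift)
  obtain p where p: "approximates p g a" using approximates_exist[OF g] by blast
  obtain u where u: "a < u" "spr T \<subseteq> {u..max_sp H T}" using spectrum_subset_interval by blast
  define q where "q = (\<lambda>n. p n - pcompose (p n) [:m, 1:])"
  have q: "Re (ip (rpoly T (q n) x) x) = Re (ip (rpoly T (p n) x) x) - Re (ip (rpoly ?U (p n) x) x)" for n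
    unfolding q_def map_poly_of_real_diff rpoly_shift[OF x] using x by (simp add: papp_diff)
  have lim: "(\<lambda>n. Re (ip (rpoly T (q n) x) x)) \<longlonglongrightarrow> Re (ip (cfc H g T x) x) - Re (ip (cfc H g ?U x) x)"
    unfolding q by (intro tendsto_diff tendsto_Re cfc_tendsto_ip[OF p x x] U.cfc_tendsto_ip[OF p x x])
  have "(\<kappa> - e) * (nm x)\<^sup>2 \<le> Re (ip (cfc H g T x) x) - Re (ip (cfc H g ?U x) x)" if "e > 0" for e
  proof (rule tendsto_lowerbound[OF lim])
    have "\<forall>\<^sub>F n in sequentially. \<forall>t\<in>{u..max_sp H T + m}. dist (poly (p n) t) (g t) < e / 2"
      by (rule uniform_limitD) (use p u \<open>e > 0\<close> in \<open>auto simp: approximates_def\<close>)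
    then show "\<forall>\<^sub>F n in sequentially. (\<kappa> - e) * (nm x)\<^sup>2 \<le> Re (ip (rpoly T (q n) x) x)"
    proof (rule eventually_mono)
      fix n assume n: "\<forall>t\<in>{u..max_sp H T + m}. dist (poly (p n) t) (g t) < e / 2"
      show "(\<kappa> - e) * (nm x)\<^sup>2 \<le> Re (ip (rpoly T (q n) x) x)"
      proof (rule rpoly_form_ge[OF sa nontriv _ x])
        fix t assume "complex_of_real t \<in> sp H T"
        then have t: "t \<in> spr T" by simp
        then have "t \<in> {u..max_sp H T + m}" "t + m \<in> {u..max_sp H T + m}"
          using u(2) \<open>0 \<le> m\<close> by force+
        then have "\<bar>poly (p n) t - g t\<bar> < e / 2" "\<bar>poly (p n) (t + m) - g (t + m)\<bar> < e / 2"
          using n by (auto simp: dist_real_def)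
        moreover have "poly (q n) t = poly (p n) t - poly (p n) (t + m)"
          by (simp add: q_def poly_pcompose add.commute)
        ultimately show "\<kappa> - e \<le> poly (q n) t" using \<kappa>[OF t] by linarith
      qed
    qed
  qed simp
  then have "\<forall>\<^sub>F e in at_right 0. (\<kappa> - e) * (nm x)\<^sup>2 \<le> Re (ip (cfc H g T x) x) - Re (ip (cfc H g ?U x) x)"
    by (auto simp: eventually_at_right_field intro!: exI[of _ 1])
  moreover have "((\<lambda>e. (\<kappa> - e) * (nm x)\<^sup>2) \<longlongrightarrow> \<kappa> * (nm x)\<^sup>2) (at_right 0)"
    by (auto intro!: tendsto_eq_intros)
  ultimately show ?thesis by (intro tendsto_upperbound) auto
qed

end

section \<open>Monotonicity of strongly operator convex functions\<close>

theorem theorem3p3: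
  fixes H :: "'v hilbert"
    and A B :: "'v \<Rightarrow> 'v"
    and a :: real
    and g :: "real \<Rightarrow> real"
  assumes "hilbert_space H"
    and "carrier H \<noteq> {\<zero>\<^bsub>H\<^esub>}"
    and "g \<in> SOC TYPE('v) {a<..}"
    and "\<exists>t\<in>{a<..}. g t \<noteq> 0"
    and "\<not> g constant_on {a<..}"
    and "selfadjoint H A"
    and "selfadjoint H B"
    and "sp H A \<subseteq> complex_of_real ` {a<..}"
    and "sp H B \<subseteq> complex_of_real ` {a<..}"
  shows "(op_gt H A B \<longrightarrow> op_gt H (cfc H g B) (cfc H g A)) \<and>
    (\<forall>m::real. m > 0 \<and> op_ge H (op_diff H A B) (op_scalar H (complex_of_real m)) \<longrightarrow>
      op_ge H (op_diff H (cfc H g B) (cfc H g A))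
        (op_scalar H (complex_of_real (g (max_sp H B) - g (max_sp H B + m)))) \<and>
      g (max_sp H B) - g (max_sp H B + m) \<ge> g (max_sp H A - m) - g (max_sp H A) \<and>
      g (max_sp H A - m) - g (max_sp H A) > 0)"
proof -
  interpret hspace H by unfold_locales (rule assms(1))
  note nontriv = assms(2) and g = assms(3) and cont = SOC_continuous[OF assms(3)]
  have A: "hspace_op H A a" and B: "hspace_op H B a"
    using assms by unfold_locales auto
  interpret A: hspace_op H A a by (rule A)
  interpret B: hspace_op H B a by (rule B)
  obtain p where p: "approximates p g a" using approximates_exist[OF cont] by blast
  note gA_sa = A.cfc_selfadjoint[OF p] and gB_sa = B.cfc_selfadjoint[OF p]
  have ii: "(\<forall>x\<in>C. (g (max_sp H B) - g (max_sp H B + m)) * (nm x)\<^sup>2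
          \<le> Re (ip (cfc H g B x) x) - Re (ip (cfc H g A x) x))
        \<and> g (max_sp H A - m) - g (max_sp H A) \<le> g (max_sp H B) - g (max_sp H B + m)
        \<and> 0 < g (max_sp H A - m) - g (max_sp H A)"
    if "m > 0" and gap: "\<And>x. x \<in> C \<Longrightarrow> m * (nm x)\<^sup>2 \<le> Re (ip (A x) x) - Re (ip (B x) x)" for m
  proof -
    \<comment> \<open>This is \<open>B + m\<close>.\<close>
    let ?U = "op_diff H B (op_scalar H (of_real (- m)))"
    have U_form: "Re (ip (?U x) x) = Re (ip (B x) x) + m * (nm x)\<^sup>2" if "x \<in> C" for x
      using that by (simp add: nm_sq)
    obtain \<beta> where \<beta>: "a < \<beta>" "\<And>x. x \<in> C \<Longrightarrow> \<beta> * (nm x)\<^sup>2 \<le> Re (ip (B x) x)"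
      using B.form_gt by blast
    have U: "hspace_op H ?U a"
    proof (rule hspace_opI[OF sa_diff[OF B.sa sa_scalar] nontriv \<beta>(1)])
      fix x assume "x \<in> C"
      then show "\<beta> * (nm x)\<^sup>2 \<le> Re (ip (?U x) x)"
        using \<beta>(2)[of x] \<open>m > 0\<close> U_form[of x] by (simp add: add_increasing2 del: op_diff_apply)
    qed
    obtain u where u: "a < u" "spr B \<subseteq> {u..max_sp H B}" using B.spectrum_subset_interval by blast
    have \<sigma>B: "a < max_sp H B" using max_sp_in_spectrum(1)[OF B.sa nontriv] B.spec by auto
    have \<sigma>AB: "max_sp H B \<le> max_sp H A - m"
    proof (rule max_sp_le[OF B.sa nontriv])
      fix x assume x: "x \<in> C"
      show "Re (ip (B x) x) \<le> (max_sp H A - m) * (nm x)\<^sup>2"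
        using gap[OF x] max_sp_in_spectrum(2)[OF A.sa nontriv x] by (simp add: algebra_simps)
    qed
    have "(g (max_sp H B) - g (max_sp H B + m)) * (nm x)\<^sup>2
        \<le> Re (ip (cfc H g B x) x) - Re (ip (cfc H g A x) x)" if x: "x \<in> C" for x
    proof -
      have "(g (max_sp H B) - g (max_sp H B + m)) * (nm x)\<^sup>2
          \<le> Re (ip (cfc H g B x) x) - Re (ip (cfc H g ?U x) x)"
      proof (rule B.cfc_shift_form[OF cont _ U _ x])
        fix t assume "t \<in> spr B"
        then have "a < t" "t \<le> max_sp H B" using u by force+
        then show "g (max_sp H B) - g (max_sp H B + m) \<le> g t - g (t + m)"
          using SOC_increment_mono[OF nontriv g] \<open>m > 0\<close> by simp
      qed (use \<open>m > 0\<close> in simp)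
      moreover have "Re (ip (cfc H g A x) x) \<le> Re (ip (cfc H g ?U x) x)"
      proof (rule SOC_antimono[OF g U A _ x])
        fix y assume y: "y \<in> C"
        show "Re (ip (?U y) y) \<le> Re (ip (A y) y)" unfolding U_form[OF y] using gap[OF y] by simp
      qed
      ultimately show ?thesis by simp
    qed
    moreover have "g (max_sp H A - m) - g (max_sp H A) \<le> g (max_sp H B) - g (max_sp H B + m)"
      using SOC_increment_mono[OF nontriv g \<sigma>B \<sigma>AB, of m] \<open>m > 0\<close> by simp
    moreover have "g (max_sp H A) < g (max_sp H A - m)"
      using SOC_strict_antimono[OF nontriv g assms(5), of "max_sp H A - m" "max_sp H A"] \<sigma>B \<sigma>AB \<open>m > 0\<close>
      by simp
    ultimately show ?thesis by simp
  qed
  have i: "op_gt H (cfc H g B) (cfc H g A)" if gt: "op_gt H A B"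
  proof -
    let ?D = "op_diff H A B" and ?G = "op_diff H (cfc H g B) (cfc H g A)"
    have D: "selfadjoint H ?D" using A.sa B.sa by simp
    have G: "selfadjoint H ?G" using gA_sa gB_sa by simp
    obtain m where m: "m > 0" "\<And>x. x \<in> C \<Longrightarrow> m * (nm x)\<^sup>2 \<le> Re (ip (?D x) x)"
    proof (rule invertible_positive_coercive[of ?D])
      show "op_invertible H ?D" using gt by (simp add: op_gt_def)
      show "0 \<le> Re (ip (?D x) x)" if "x \<in> C" for x
        using gt that by (simp add: op_gt_def op_pos_def complex_nonneg_Reals_iff)
      show "ip (?D x) y = ip x (?D y)" if "x \<in> C" "y \<in> C" for x y
        by (rule sa_sym[OF D that])
    qed (use D in simp_all)
    have "m * (nm x)\<^sup>2 \<le> Re (ip (A x) x) - Re (ip (B x) x)" if "x \<in> C" for x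
      using m(2)[OF that] that by simp
    note * = ii[OF m(1) this]
    define \<kappa> where "\<kappa> = g (max_sp H B) - g (max_sp H B + m)"
    have "\<kappa> > 0" using * by (simp add: \<kappa>_def)
    have form: "\<kappa> * (nm x)\<^sup>2 \<le> Re (ip (?G x) x)" if "x \<in> C" for x
      using * that gA_sa gB_sa by (simp add: \<kappa>_def)
    have "op_invertible H ?G"
      using G by (intro coercive_invertible[OF _ \<open>\<kappa> > 0\<close> form]) auto
    moreover have "ip (?G x) x \<in> \<real>\<^sub>\<ge>\<^sub>0" if "x \<in> C" for x
    proof -
      have "0 \<le> \<kappa> * (nm x)\<^sup>2" using \<open>\<kappa> > 0\<close> by simp
      also have "\<dots> \<le> Re (ip (?G x) x)" by (rule form[OF that])
      finally show ?thesis using sa_Im[OF G that] by (simp add: complex_nonneg_Reals_iff)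
    qed
    ultimately show ?thesis unfolding op_gt_def op_pos_def by blast
  qed
  show ?thesis
  proof (intro conjI impI allI; (elim conjE)?)
    show "op_gt H (cfc H g B) (cfc H g A)" if "op_gt H A B" using i that .
    fix m :: real
    assume "m > 0" and "op_ge H (op_diff H A B) (op_scalar H (of_real m))"
    then have "m * (nm x)\<^sup>2 \<le> Re (ip (A x) x) - Re (ip (B x) x)" if "x \<in> C" for x
      using that op_ge_iff[OF sa_diff[OF A.sa B.sa] sa_scalar] by (simp add: nm_sq)
    note * = ii[OF \<open>m > 0\<close> this]
    show "op_ge H (op_diff H (cfc H g B) (cfc H g A))
        (op_scalar H (of_real (g (max_sp H B) - g (max_sp H B + m))))"
      unfolding op_ge_iff[OF sa_diff[OF gB_sa gA_sa] sa_scalar]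
    proof
      fix x assume x: "x \<in> C"
      have "cfc H g A x \<in> C" "cfc H g B x \<in> C" using gA_sa gB_sa x by simp_all
      then show "Re (ip (op_scalar H (of_real (g (max_sp H B) - g (max_sp H B + m))) x) x)
          \<le> Re (ip (op_diff H (cfc H g B) (cfc H g A) x) x)"
        using * x by (simp add: nm_sq)
    qed
    show "g (max_sp H A - m) - g (max_sp H A) \<le> g (max_sp H B) - g (max_sp H B + m)"
      and "0 < g (max_sp H A - m) - g (max_sp H A)" using * by blast+
  qed
qed

end
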